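(* Assume the following: (i) $\Delta(N)\to\infty$ and $\Delta(N)=o(N)$ as $N\to\infty$; (ii) $\pi_{1N}\ge 1/[\Delta(N)+1]$ and $\pi_{\Delta(N)N}\le 1-1/[\Delta(N)+1]$; (iii) $\{w_N\}$ is a sequence of positive numbers such that $w_N\to0$, $Nw_N^2/\log N\to\infty$, and, for some $\upsilon\in(0,1)$, $w_N^{1-\upsilon}\Delta(N)\to0$ as $N\to\infty$. Then $$-\lim_{N\to\infty}\frac1{Nw_N^2}\log P_0^N\bigl(\mathcal T_N\ge w_N\sqrt N\bigr)=\frac12 .$$
   Context: $X_1,\dots,X_m$ and $Y_1,\dots,Y_n$ are independent samples of i.i.d. real random variables, $m=m(N)$, $n=n(N)$, $m+n=N$, $\eta_N=m(N)/N\to\eta\in(0,1)$ as $N\to\infty$. $(F_1,G_1)$ is a fixed pair of continuous distribution functions on $\mathbb R$ with $F_1(z)<G_1(z)$ for some $z$, and $F_0=J_1$, where $J_1(z)=\eta F_1(z)+(1-\eta)G_1(z)$. $P_0$ is the probability measure with distribution function $F_0$ and $P_0^N$ its $N$-fold product; thus under $P_0^N$ all $N$ observations are i.i.d. with continuous distribution function $F_0$. $\Delta(N)$ is a non-decreasing sequence of natural numbers with $1<\Delta(N)\le N$, and $0<\pi_{1N}<\pi_{2N}<\dots<\pi_{\Delta(N)N}<1$ are given numbers. For $j=1,\dots,\Delta(N)$ and $t\in[0,1]$, $$\ell_j(t)=-\sqrt{\frac{1-\pi_{jN}}{\pi_{jN}}}\,\mathbf 1(0\le t<\pi_{jN})+\sqrt{\frac{\pi_{jN}}{1-\pi_{jN}}}\,\mathbf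 1(\pi_{jN}\le t\le1).$$ $R_i$ is the rank, in the pooled sample $X_1,\dots,X_m,Y_1,\dots,Y_n$, of the $i$-th element of this pooled sample (so $R_1,\dots,R_m$ are the ranks of the $X$'s and $R_{m+1},\dots,R_N$ those of the $Y$'s). Put $c_{Ni}=-\sqrt{mn/N}\,m^{-1}$ for $1\le i\le m$, $c_{Ni}=\sqrt{mn/N}\,n^{-1}$ for $m<i\le N$, $$\mathcal L_j=\sum_{i=1}^Nc_{Ni}\,\ell_j\Bigl(\frac{R_i-0.5}{N}\Bigr),\qquad \mathcal T_N=\max_{1\le j\le\Delta(N)}\{-\mathcal L_j\}.$$ *)

theory Defs
  imports "HOL-Probability.Probability" "HOL-Library.Landau_Symbols"
begin

definition distribution_function :: "(real \<Rightarrow> real) \<Rightarrow> bool" where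
  "distribution_function F \<longleftrightarrow> (\<exists>M. real_distribution M \<and> F = cdf M)"

definition ell :: "real \<Rightarrow> real \<Rightarrow> real" where
  "ell p t = - sqrt ((1 - p) / p) * indicat_real {0..<p} t
             + sqrt (p / (1 - p)) * indicat_real {p..1} t"

(* The pooled sample is a function z on {1..N}: z 1, ..., z m are the X's and
   z (m + 1), ..., z (m + n) are the Y's, with N = m + n.
   Tied observations all receive the largest of the ranks they occupy. *)
definition pooled_rank :: "nat \<Rightarrow> (nat \<Rightarrow> real) \<Rightarrow> nat \<Rightarrow> nat" where
  "pooled_rank N z i = card {k \<in> {1..N}. z k \<le> z i}"

definition coeff_c :: "nat \<Rightarrow> nat \<Rightarrow> nat \<Rightarrow> real" where
  "coeff_c m n i =
     (if i \<le> m then - sqrt (real m * real n / real (m + n)) * inverse (real m)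
      else sqrt (real m * real n / real (m + n)) * inverse (real n))"

definition rank_stat :: "nat \<Rightarrow> nat \<Rightarrow> real \<Rightarrow> (nat \<Rightarrow> real) \<Rightarrow> real" where
  "rank_stat m n p z =
     (\<Sum>i = 1..m + n. coeff_c m n i * ell p ((real (pooled_rank (m + n) z i) - 0.5) / real (m + n)))"

(* Meaningful only for d \<ge> 1, where the maximum ranges over a nonempty set. *)
definition max_stat :: "nat \<Rightarrow> nat \<Rightarrow> nat \<Rightarrow> (nat \<Rightarrow> real) \<Rightarrow> (nat \<Rightarrow> real) \<Rightarrow> real" where
  "max_stat m n d p z = Max ((\<lambda>j. - rank_stat m n (p j) z) ` {1..d})"

end

theory Submission
  imports Defs
begin

text \<open>
  Since the observations are i.i.d. with a continuous law, ties have probability zero and the set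
  of the \<open>k\<close> lowest-ranked observations is a uniformly distributed \<open>k\<close>-subset of the \<open>N\<close> indices
  (lemma \<open>measure_low_ranked_event\<close>). Hence the number \<open>H\<close> of first-sample observations among the
  \<open>k\<close> lowest is hypergeometric. The score function \<open>ell p\<close> takes only two values and the
  coefficients sum to zero, so with \<open>k\<close> the number of midranks \<open>(r - 1/2) / N\<close> below \<open>p\<close> and
  \<open>\<theta> = k / N\<close>, the rank statistic \<open>L\<close> at \<open>p\<close> satisfies
  \<open>- L = (m \<theta> - H) / \<surd>((m n / N) p (1 - p))\<close> almost surely (lemma \<open>rank_stat_eq\<close>). The event \<open>- L \<ge> w \<surd>N\<close> is therefore the lower tail event
  \<open>H \<le> m \<theta> - D\<close> with \<open>D = w \<surd>(m n p (1 - p))\<close>.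

  The variance of \<open>H\<close> is about \<open>\<theta> (1 - \<theta>) / (1 / m + 1 / n)\<close>, so the expected exponent is
  \<open>D\<^sup>2 (1 / m + 1 / n) / (2 \<theta> (1 - \<theta>)) = N w\<^sup>2 p (1 - p) / (2 \<theta> (1 - \<theta>))\<close>, which is \<open>N w\<^sup>2 / 2\<close> up to
  the rounding of \<open>p\<close> to \<open>\<theta>\<close>. To prove it, \<open>H\<close> is viewed as a binomial \<open>(m, \<theta>)\<close> variable
  conditioned on its sum with an independent binomial \<open>(n, \<theta>)\<close> variable being \<open>k\<close>. Because
  \<open>k = N \<theta>\<close> is the mode of that sum, the conditioning costs at most a factor \<open>N + 1\<close>. The upper bound
  is then a Chernoff bound in both variables (\<open>hypergeometric_tail_le_gaussian\<close>), and the lower bound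
  keeps the single largest term, whose relative entropies are expanded to second order
  (\<open>hypergeometric_tail_ge_gaussian\<close>).

  All polynomial factors, including the factor \<open>\<Delta> \<le> N\<close> of the union bound over the cut points, are
  negligible because \<open>log N = o(N w\<^sup>2)\<close>. The Gaussian approximation is uniform over the cut points:
  \<open>p (1 - p)\<close> is at least of order \<open>1 / \<Delta>\<close>, so \<open>\<Delta> = o(N)\<close> controls the rounding of \<open>p\<close> to \<open>\<theta>\<close>, and
  \<open>w\<^sup>2 \<Delta> \<longlonglongrightarrow> 0\<close> makes the third-order terms small (\<open>rank_stat_tail_bounds\<close>). A lower bound for the maximum
  needs one cut point only, and any of them will do.
\<close>

section \<open>Estimates for single binomial probabilities\<close>

text \<open>
  Stated without denominators: up to the common factor \<open>N ^ N\<close> these are the binomial probabilities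
  with success probability \<open>k / N\<close>. Successive terms have ratio \<open>(N - j) k / ((j + 1) (N - k))\<close>, which
  is at least \<open>1\<close> for \<open>j < k\<close> and at most \<open>1\<close> for \<open>j \<ge> k\<close>.
\<close>

lemma binomial_term_le_mode:
  fixes N k j :: nat
  assumes "k \<le> N" "j \<le> N"
  shows "(N choose j) * k ^ j * (N - k) ^ (N - j) \<le> (N choose k) * k ^ k * (N - k) ^ (N - k)"
proof -
  define T where "T j = (N choose j) * k ^ j * (N - k) ^ (N - j)" for j
  define X where "X j = (N choose j) * k ^ j * (N - k) ^ (N - Suc j)" for j
  have 1: "Suc j * T (Suc j) = X j * ((N - j) * k)" if "j < N" for j
  proof -
    have "Suc j * (N choose Suc j) = (N - j) * (N choose j)"
      using that by (metis Suc_pred binomial_absorb_comp binomial_absorption diff_is_0_eq' neq0_conv not_le zero_less_diff)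
    hence "Suc j * (N choose Suc j) * (k ^ Suc j * (N - k) ^ (N - Suc j))
        = (N - j) * (N choose j) * (k ^ Suc j * (N - k) ^ (N - Suc j))"
      by simp
    thus ?thesis unfolding T_def X_def power_Suc by (simp only: ac_simps)
  qed
  have 2: "Suc j * T j = X j * (Suc j * (N - k))" if "j < N" for j
    using that Suc_diff_Suc[OF that, symmetric] unfolding T_def X_def by (simp add: algebra_simps)
  have up: "T j \<le> T (Suc j)" if "j < k" for j
  proof -
    have "Suc j * (N - k) \<le> k * (N - j)"
      using that by (intro mult_mono) auto
    hence "Suc j * T j \<le> Suc j * T (Suc j)"
      using 1[of j] 2[of j] that assms by (simp add: mult.commute del: mult_Suc mult_Suc_right)
    thus ?thesis by (simp del: mult_Suc)
  qed
  have down: "T (Suc j) \<le> T j" if "k \<le> j" "j < N" for j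
  proof -
    have "(N - j) * k \<le> (N - k) * Suc j"
      using that by (intro mult_mono) auto
    hence "Suc j * T (Suc j) \<le> Suc j * T j"
      using 1[of j] 2[of j] that assms by (simp add: mult.commute del: mult_Suc mult_Suc_right)
    thus ?thesis by (simp del: mult_Suc)
  qed
  have "T j \<le> T k"
  proof (cases "j \<le> k")
    case True
    thus ?thesis
      by (induction rule: inc_induct) (auto intro: up order_trans)
  next
    case False
    hence "k \<le> j" by simp
    thus ?thesis using assms(2)
      by (induction rule: dec_induct) (auto intro: order_trans[OF down])
  qed
  thus ?thesis by (simp add: T_def)
qed

text \<open>The largest of \<open>N + 1\<close> terms is at least their average.\<close>

lemma binomial_mode_lower_bound:
  fixes N k :: nat
  assumes "k \<le> N"
  shows "N ^ N \<le> (N + 1) * ((N choose k) * k ^ k * (N - k) ^ (N - k))"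
proof -
  have "N ^ N = (k + (N - k)) ^ N" using assms by simp
  also have "\<dots> = (\<Sum>j\<le>N. (N choose j) * k ^ j * (N - k) ^ (N - j))"
    by (subst binomial) simp
  also have "\<dots> \<le> (\<Sum>j\<le>N. (N choose k) * k ^ k * (N - k) ^ (N - k))"
    using assms by (intro sum_mono binomial_term_le_mode) auto
  finally show ?thesis by simp
qed

lemma binomial_mode_lower_bound_real:
  fixes N k :: nat
  assumes "k \<le> N" "0 < N"
  shows "1 / (real N + 1) \<le> (N choose k) * (k / N) ^ k * (1 - k / N) ^ (N - k)"
proof -
  have "real (N ^ N) \<le> real ((N + 1) * ((N choose k) * k ^ k * (N - k) ^ (N - k)))"
    using binomial_mode_lower_bound[OF assms(1)] by (rule of_nat_mono)
  hence *: "real N ^ N \<le> (real N + 1) * ((N choose k) * real k ^ k * real (N - k) ^ (N - k))"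
    by (simp only: of_nat_mult of_nat_power of_nat_add of_nat_1)
  have "1 - k / N = real (N - k) / N"
    using assms by (simp add: field_simps of_nat_diff)
  hence "(N choose k) * (k / N) ^ k * (1 - k / N) ^ (N - k)
     = (N choose k) * real k ^ k * real (N - k) ^ (N - k) / (real N ^ k * real N ^ (N - k))"
    by (simp add: power_divide)
  also have "real N ^ k * real N ^ (N - k) = real N ^ N"
    using assms by (simp flip: power_add)
  finally have eq: "(N choose k) * (k / N) ^ k * (1 - k / N) ^ (N - k)
     = (N choose k) * real k ^ k * real (N - k) ^ (N - k) / real N ^ N" .
  show ?thesis
    unfolding eq using * assms(2) by (simp add: divide_simps mult.commute)
qed


lemma ln_one_plus_le_cubic:
  fixes u :: real
  assumes "- 1 < u"
  shows "ln (1 + u) \<le> u - u\<^sup>2 / 2 + u ^ 3 / 3"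
proof -
  define g where "g v = v - v\<^sup>2 / 2 + v ^ 3 / 3 - ln (1 + v)" for v :: real
  have d: "(g has_real_derivative v ^ 3 / (1 + v)) (at v)" if "- 1 < v" for v
  proof -
    have "(g has_real_derivative (1 - v + v\<^sup>2 - 1 / (1 + v))) (at v)"
      unfolding g_def using that by (auto intro!: derivative_eq_intros)
    moreover have "1 - v + v\<^sup>2 - 1 / (1 + v) = v ^ 3 / (1 + v)"
      using that by (simp add: field_simps power2_eq_square power3_eq_cube)
    ultimately show ?thesis by simp
  qed
  have "g 0 \<le> g u"
  proof (cases "0 \<le> u")
    case True
    show ?thesis
      by (rule DERIV_nonneg_imp_nondecreasing[OF True]) (use d in force)
  next
    case False
    hence "u \<le> 0" by simp
    show ?thesis
    proof (rule DERIV_nonpos_imp_nonincreasing[OF \<open>u \<le> 0\<close>])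
      fix v assume "u \<le> v" "v \<le> 0"
      hence "v ^ 3 / (1 + v) \<le> 0" using assms
        by (simp add: divide_le_0_iff power_le_zero_eq)
      thus "\<exists>y. (g has_real_derivative y) (at v) \<and> y \<le> 0"
        using d[of v] \<open>u \<le> v\<close> assms by force
    qed
  qed
  thus ?thesis by (simp add: g_def)
qed

text \<open>
  The function on the left is the building block of the relative entropy between two Bernoulli laws.
\<close>

lemma one_plus_mult_ln_le:
  fixes u :: real
  assumes "\<bar>u\<bar> < 1"
  shows "(1 + u) * ln (1 + u) \<le> u + u\<^sup>2 / 2 * (1 + \<bar>u\<bar>)"
proof -
  have "(1 + u) * ln (1 + u) \<le> (1 + u) * (u - u\<^sup>2 / 2 + u ^ 3 / 3)"
    using assms by (intro mult_left_mono ln_one_plus_le_cubic) auto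
  also have "\<dots> = u + u\<^sup>2 / 2 * (1 + (- u / 3 + 2 * u\<^sup>2 / 3))"
    by (simp add: field_simps power2_eq_square power3_eq_cube)
  also have "\<dots> \<le> u + u\<^sup>2 / 2 * (1 + \<bar>u\<bar>)"
  proof -
    have "u\<^sup>2 \<le> \<bar>u\<bar>" using assms
      by (metis abs_ge_zero less_imp_le mult_left_le power2_abs power2_eq_square)
    hence "- u / 3 + 2 * u\<^sup>2 / 3 \<le> \<bar>u\<bar>" by linarith
    thus ?thesis by (intro add_left_mono mult_left_mono) auto
  qed
  finally show ?thesis .
qed

text \<open>
  The probability of \<open>h\<close> successes is compared with its value under the success probability
  \<open>q = h / m\<close>, for which \<open>h\<close> is the mode. The likelihood ratio is the exponential of \<open>- m\<close> times the
  relative entropy of \<open>q\<close> with respect to \<open>\<theta>\<close>, whose second-order expansion gives the exponent.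
\<close>

lemma binomial_prob_ge:
  fixes m h :: nat and \<theta> \<epsilon> :: real
  assumes th: "0 < \<theta>" "\<theta> < 1" and m: "0 < m" and eps: "\<epsilon> < 1"
    and x: "\<bar>h / m - \<theta>\<bar> \<le> \<epsilon> * (\<theta> * (1 - \<theta>))"
  shows "exp (- (m * (h / m - \<theta>)\<^sup>2 * (1 + \<epsilon>) / (2 * \<theta> * (1 - \<theta>)))) / (real m + 1)
         \<le> (m choose h) * \<theta> ^ h * (1 - \<theta>) ^ (m - h)"
proof -
  define q x where "q = h / m" and "x = q - \<theta>"
  have pos: "0 < \<theta> * (1 - \<theta>)" using th by simp
  have "0 \<le> \<epsilon>"
    using x pos by (smt (verit) mult_neg_pos)
  have ax: "\<bar>x\<bar> \<le> \<epsilon> * (\<theta> * (1 - \<theta>))" using x by (simp add: x_def q_def)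
  have u: "\<bar>x / \<theta>\<bar> \<le> \<epsilon>"
  proof -
    have "\<bar>x\<bar> \<le> \<epsilon> * \<theta>"
      using ax th \<open>0 \<le> \<epsilon>\<close> by (smt (verit) mult_left_le mult_left_mono)
    thus ?thesis using th by (simp add: field_simps)
  qed
  have v: "\<bar>- x / (1 - \<theta>)\<bar> \<le> \<epsilon>"
  proof -
    have "\<bar>x\<bar> \<le> \<epsilon> * (1 - \<theta>)"
      using ax th \<open>0 \<le> \<epsilon>\<close> by (smt (verit) mult_left_le mult_left_mono mult.commute)
    thus ?thesis using th by (simp add: field_simps)
  qed
  have lt1: "\<bar>x / \<theta>\<bar> < 1" "\<bar>- x / (1 - \<theta>)\<bar> < 1"
    using u v eps by linarith+
  have q1: "q = \<theta> * (1 + x / \<theta>)" and q2: "1 - q = (1 - \<theta>) * (1 + (- x / (1 - \<theta>)))"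
    using th by (auto simp: x_def field_simps)
  have q: "0 < q" "q < 1"
  proof -
    have "0 < 1 + x / \<theta>" "0 < 1 + (- x / (1 - \<theta>))"
      using lt1 by linarith+
    hence "0 < \<theta> * (1 + x / \<theta>)" "0 < (1 - \<theta>) * (1 + (- x / (1 - \<theta>)))"
      using th by (auto intro!: mult_pos_pos)
    thus "0 < q" "q < 1" using q1 q2 by linarith+
  qed
  hence h: "0 < h" "h < m" using m by (auto simp: q_def zero_less_divide_iff)
  have k1: "q * ln (q / \<theta>) \<le> x + x\<^sup>2 / (2 * \<theta>) * (1 + \<epsilon>)"
  proof -
    have "q * ln (q / \<theta>) = \<theta> * ((1 + x / \<theta>) * ln (1 + x / \<theta>))"
      using th by (simp add: q1)
    also have "\<dots> \<le> \<theta> * (x / \<theta> + (x / \<theta>)\<^sup>2 / 2 * (1 + \<bar>x / \<theta>\<bar>))"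
      using lt1 th by (intro mult_left_mono one_plus_mult_ln_le) auto
    also have "\<dots> \<le> \<theta> * (x / \<theta> + (x / \<theta>)\<^sup>2 / 2 * (1 + \<epsilon>))"
      using u th by (intro mult_left_mono add_left_mono) auto
    also have "\<dots> = x + x\<^sup>2 / (2 * \<theta>) * (1 + \<epsilon>)"
      using th by (simp add: field_simps power2_eq_square)
    finally show ?thesis .
  qed
  have k2: "(1 - q) * ln ((1 - q) / (1 - \<theta>)) \<le> - x + x\<^sup>2 / (2 * (1 - \<theta>)) * (1 + \<epsilon>)"
  proof -
    have "(1 - q) * ln ((1 - q) / (1 - \<theta>)) = (1 - \<theta>) * ((1 + (- x / (1 - \<theta>))) * ln (1 + (- x / (1 - \<theta>))))"
      using th by (simp add: q2)
    also have "\<dots> \<le> (1 - \<theta>) * (- x / (1 - \<theta>) + (- x / (1 - \<theta>))\<^sup>2 / 2 * (1 + \<bar>- x / (1 - \<theta>)\<bar>))"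
      using lt1 th by (intro mult_left_mono one_plus_mult_ln_le) auto
    also have "\<dots> \<le> (1 - \<theta>) * (- x / (1 - \<theta>) + (- x / (1 - \<theta>))\<^sup>2 / 2 * (1 + \<epsilon>))"
      using v th by (intro mult_left_mono add_left_mono) auto
    also have "\<dots> = - x + x\<^sup>2 / (2 * (1 - \<theta>)) * (1 + \<epsilon>)"
    proof -
      have "b * (- x / b + (- x / b)\<^sup>2 / 2 * (1 + \<epsilon>)) = - x + x\<^sup>2 / (2 * b) * (1 + \<epsilon>)"
        if "0 < b" for b
        using that by (simp add: field_simps power2_eq_square)
      thus ?thesis using th by simp
    qed
    finally show ?thesis .
  qed
  define R where "R = m * x\<^sup>2 * (1 + \<epsilon>) / (2 * \<theta> * (1 - \<theta>))"
  have "m * (q * ln (q / \<theta>) + (1 - q) * ln ((1 - q) / (1 - \<theta>)))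
      \<le> m * (x + x\<^sup>2 / (2 * \<theta>) * (1 + \<epsilon>) + (- x + x\<^sup>2 / (2 * (1 - \<theta>)) * (1 + \<epsilon>)))"
    by (intro mult_left_mono add_mono k1 k2) auto
  also have "\<dots> = R"
    using th by (simp add: R_def field_simps)
  finally have "h * ln (q / \<theta>) + real (m - h) * ln ((1 - q) / (1 - \<theta>)) \<le> R"
  proof -
    assume *: "m * (q * ln (q / \<theta>) + (1 - q) * ln ((1 - q) / (1 - \<theta>))) \<le> R"
    have "real h = m * q" "real (m - h) = m * (1 - q)"
      using m h by (auto simp: q_def of_nat_diff field_simps)
    thus ?thesis using * by (simp add: algebra_simps)
  qed
  hence "exp (- R) \<le> exp (- (h * ln (q / \<theta>) + real (m - h) * ln ((1 - q) / (1 - \<theta>))))"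
    by simp
  also have "\<dots> = exp (h * ln (\<theta> / q) + real (m - h) * ln ((1 - \<theta>) / (1 - q)))"
    using th q by (simp add: ln_div algebra_simps)
  also have "\<dots> = (\<theta> / q) ^ h * ((1 - \<theta>) / (1 - q)) ^ (m - h)"
    using th q by (simp add: exp_add exp_of_nat_mult)
  finally have R: "exp (- R) \<le> (\<theta> / q) ^ h * ((1 - \<theta>) / (1 - q)) ^ (m - h)" .
  have "1 / (real m + 1) \<le> (m choose h) * q ^ h * (1 - q) ^ (m - h)"
    using binomial_mode_lower_bound_real[of h m] h by (simp add: q_def)
  hence "exp (- R) * (1 / (real m + 1)) \<le> ((\<theta> / q) ^ h * ((1 - \<theta>) / (1 - q)) ^ (m - h)) *
      ((m choose h) * q ^ h * (1 - q) ^ (m - h))"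
    using R q th by (intro mult_mono) auto
  also have "\<dots> = (m choose h) * \<theta> ^ h * (1 - \<theta>) ^ (m - h)"
    using q by (simp add: power_divide)
  finally show ?thesis by (simp add: R_def x_def q_def)
qed

lemma binomial_prob_le_1:
  fixes \<theta> :: real
  assumes "0 \<le> \<theta>" "\<theta> \<le> 1" "k \<le> N"
  shows "(N choose k) * \<theta> ^ k * (1 - \<theta>) ^ (N - k) \<le> 1"
proof -
  have "(N choose k) * \<theta> ^ k * (1 - \<theta>) ^ (N - k) \<le> (\<Sum>j\<le>N. (N choose j) * \<theta> ^ j * (1 - \<theta>) ^ (N - j))"
    using assms by (intro member_le_sum) auto
  also have "\<dots> = (\<theta> + (1 - \<theta>)) ^ N" by (subst binomial_ring) simp
  finally show ?thesis by simp
qed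


section \<open>Gaussian bounds for hypergeometric tails\<close>

text \<open>
  Second-order expansions are stated with a relative error factor \<open>1 + \<bar>v\<bar>\<close>, so that the leading constant
  \<open>1 / 2\<close> survives in the limit.
\<close>

lemma exp_le_quadratic:
  fixes v :: real
  assumes "\<bar>v\<bar> \<le> 1"
  shows "exp v \<le> 1 + v + v\<^sup>2 / 2 * (1 + \<bar>v\<bar>)"
proof -
  obtain t where t: "\<bar>t\<bar> \<le> \<bar>v\<bar>" "exp v = (\<Sum>i<3. v ^ i / fact i) + exp t / fact 3 * v ^ 3"
    using Maclaurin_exp_le[of v 3] by blast
  have "exp t \<le> exp 1" using t assms by simp
  also have "\<dots> \<le> (3::real)" using exp_le by simp
  finally have "exp t \<le> 3" .
  hence "exp t * \<bar>v\<bar> ^ 3 \<le> 3 * \<bar>v\<bar> ^ 3"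
    by (intro mult_right_mono) auto
  moreover have "exp t * v ^ 3 \<le> exp t * \<bar>v\<bar> ^ 3"
    by (intro mult_left_mono) (auto simp: power_abs[symmetric] intro: abs_ge_self)
  ultimately have "exp t * v ^ 3 \<le> 3 * \<bar>v\<bar> ^ 3"
    by linarith
  moreover have "\<bar>v\<bar> ^ 3 = v\<^sup>2 * \<bar>v\<bar>" by (simp add: power3_eq_cube power2_eq_square)
  ultimately show ?thesis unfolding t(2)
    by (simp add: eval_nat_numeral algebra_simps fact_numeral)
qed

text \<open>
  The exact variance \<open>\<theta> (1 - \<theta>)\<close> in the exponent is essential. A Hoeffding bound would replace it
  by \<open>1 / 4\<close>, and a Poisson-type bound by \<open>\<theta>\<close>.
\<close>

lemma bernoulli_centered_mgf_le:
  fixes \<theta> u :: real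
  assumes "0 \<le> \<theta>" "\<theta> \<le> 1" "\<bar>u\<bar> \<le> 1"
  shows "\<theta> * exp (u * (1 - \<theta>)) + (1 - \<theta>) * exp (- (u * \<theta>))
         \<le> exp (\<theta> * (1 - \<theta>) * u\<^sup>2 * (1 + \<bar>u\<bar>) / 2)"
proof -
  have q: "exp v \<le> 1 + v + v\<^sup>2 / 2 * (1 + \<bar>u\<bar>)" if "\<bar>v\<bar> \<le> \<bar>u\<bar>" for v
  proof -
    have "exp v \<le> 1 + v + v\<^sup>2 / 2 * (1 + \<bar>v\<bar>)"
      using that assms by (intro exp_le_quadratic) auto
    also have "v\<^sup>2 / 2 * (1 + \<bar>v\<bar>) \<le> v\<^sup>2 / 2 * (1 + \<bar>u\<bar>)"
      using that by (intro mult_left_mono) auto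
    finally show ?thesis by simp
  qed
  have b: "\<bar>u * (1 - \<theta>)\<bar> \<le> \<bar>u\<bar>" "\<bar>- (u * \<theta>)\<bar> \<le> \<bar>u\<bar>"
    using assms by (auto simp: abs_mult mult_left_le)
  have "\<theta> * exp (u * (1 - \<theta>)) + (1 - \<theta>) * exp (- (u * \<theta>))
     \<le> \<theta> * (1 + u * (1 - \<theta>) + (u * (1 - \<theta>))\<^sup>2 / 2 * (1 + \<bar>u\<bar>))
       + (1 - \<theta>) * (1 + - (u * \<theta>) + (- (u * \<theta>))\<^sup>2 / 2 * (1 + \<bar>u\<bar>))"
    using assms by (intro add_mono mult_left_mono q b) auto
  also have "\<dots> = 1 + \<theta> * (1 - \<theta>) * u\<^sup>2 * (1 + \<bar>u\<bar>) / 2"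
    by (simp add: field_simps power2_eq_square)
  also have "\<dots> \<le> exp (\<theta> * (1 - \<theta>) * u\<^sup>2 * (1 + \<bar>u\<bar>) / 2)"
    by (rule exp_ge_add_one_self)
  finally show ?thesis .
qed

lemma binomial_centered_mgf_le:
  fixes \<theta> u :: real and m :: nat
  assumes "0 \<le> \<theta>" "\<theta> \<le> 1" "\<bar>u\<bar> \<le> 1"
  shows "(\<Sum>h\<le>m. (m choose h) * \<theta> ^ h * (1 - \<theta>) ^ (m - h) * exp (u * (real h - m * \<theta>)))
         \<le> exp (m * (\<theta> * (1 - \<theta>) * u\<^sup>2 * (1 + \<bar>u\<bar>) / 2))"
proof -
  have "(m choose h) * \<theta> ^ h * (1 - \<theta>) ^ (m - h) * exp (u * (real h - m * \<theta>))
     = (m choose h) * (\<theta> * exp (u * (1 - \<theta>))) ^ h * ((1 - \<theta>) * exp (- (u * \<theta>))) ^ (m - h)"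
    if "h \<le> m" for h
  proof -
    have "exp (u * (real h - m * \<theta>)) = exp (u * (1 - \<theta>)) ^ h * exp (- (u * \<theta>)) ^ (m - h)"
      using that by (simp flip: exp_of_nat_mult exp_add add: of_nat_diff algebra_simps)
    thus ?thesis by (simp add: power_mult_distrib)
  qed
  hence "(\<Sum>h\<le>m. (m choose h) * \<theta> ^ h * (1 - \<theta>) ^ (m - h) * exp (u * (real h - m * \<theta>)))
     = (\<Sum>h\<le>m. (m choose h) * (\<theta> * exp (u * (1 - \<theta>))) ^ h * ((1 - \<theta>) * exp (- (u * \<theta>))) ^ (m - h))"
    by (intro sum.cong) auto
  also have "\<dots> = (\<theta> * exp (u * (1 - \<theta>)) + (1 - \<theta>) * exp (- (u * \<theta>))) ^ m"
    by (subst binomial_ring) simp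
  also have "\<dots> \<le> exp (\<theta> * (1 - \<theta>) * u\<^sup>2 * (1 + \<bar>u\<bar>) / 2) ^ m"
    using assms by (intro power_mono bernoulli_centered_mgf_le) auto
  also have "\<dots> = exp (m * (\<theta> * (1 - \<theta>) * u\<^sup>2 * (1 + \<bar>u\<bar>) / 2))"
    by (rule exp_of_nat_mult[symmetric])
  finally show ?thesis .
qed

text \<open>
  Multiplying the summand by \<open>c = \<theta> ^ k * (1 - \<theta>) ^ (N - k)\<close> turns it into a product of a binomial
  probability for \<open>h\<close> among \<open>m\<close> and one for \<open>k - h\<close> among \<open>n\<close>. On the tail event the first count is
  at least \<open>D\<close> below its mean and the second at least \<open>D\<close> above, so each can be tilted exponentially with
  its own parameter. The factor \<open>c\<close> is removed by the lower bound for the binomial mode.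
\<close>

lemma hypergeometric_tail_le:
  fixes m n k :: nat and D s t \<theta> :: real
  defines "\<theta> \<equiv> real k / real (m + n)"
  assumes k: "k \<le> m + n" "0 < m + n" and s: "0 \<le> s" "s \<le> 1" and t: "0 \<le> t" "t \<le> 1"
  shows "(\<Sum>h | h \<le> k \<and> real h \<le> m * \<theta> - D. real ((m choose h) * (n choose (k - h))))
       \<le> (real (m + n) + 1) * ((m + n) choose k)
         * exp (- (s + t) * D + \<theta> * (1 - \<theta>) * (m * s\<^sup>2 * (1 + s) + n * t\<^sup>2 * (1 + t)) / 2)"
proof -
  define N where "N = m + n"
  define a where "a h = (m choose h) * \<theta> ^ h * (1 - \<theta>) ^ (m - h) * exp (- s * (real h - m * \<theta>))" for h
  define b where "b y = (n choose y) * \<theta> ^ y * (1 - \<theta>) ^ (n - y) * exp (t * (real y - n * \<theta>))" for y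
  define c where "c = \<theta> ^ k * (1 - \<theta>) ^ (N - k)"
  define H where "H = {h. h \<le> k \<and> real h \<le> m * \<theta> - D}"
  have th: "0 \<le> \<theta>" "\<theta> \<le> 1" using k by (auto simp: \<theta>_def)
  have nn: "0 \<le> a h" "0 \<le> b h" for h using th by (auto simp: a_def b_def)
  have fin: "finite H" unfolding H_def by (rule finite_subset[of _ "{..k}"]) auto
  have sa: "(\<Sum>h\<le>m. a h) \<le> exp (m * (\<theta> * (1 - \<theta>) * s\<^sup>2 * (1 + s) / 2))"
    using binomial_centered_mgf_le[OF th, of "-s" m] s by (simp add: a_def)
  have sb: "(\<Sum>y\<le>n. b y) \<le> exp (n * (\<theta> * (1 - \<theta>) * t\<^sup>2 * (1 + t) / 2))"
    using binomial_centered_mgf_le[OF th, of t n] t by (simp add: b_def)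
  have "real k = real (m + n) * \<theta>" using k by (simp add: \<theta>_def)
  hence kN: "real k = m * \<theta> + n * \<theta>" by (simp add: distrib_right)
  have c0: "0 \<le> c" using th by (simp add: c_def)
  have summand: "real ((m choose h) * (n choose (k - h))) * c * exp ((s + t) * D) \<le> a h * b (k - h)"
    if "h \<in> H" for h
  proof (cases "h \<le> m \<and> k - h \<le> n")
    case True
    have hk: "h \<le> k" "real h \<le> m * \<theta> - D" using that by (auto simp: H_def)
    have c: "c = \<theta> ^ h * (1 - \<theta>) ^ (m - h) * (\<theta> ^ (k - h) * (1 - \<theta>) ^ (n - (k - h)))"
    proof -
      have "\<theta> ^ k = \<theta> ^ h * \<theta> ^ (k - h)" using hk by (simp flip: power_add)
      moreover have "N - k = (m - h) + (n - (k - h))" using True hk(1) unfolding N_def by arith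
      ultimately show ?thesis by (simp add: c_def power_add)
    qed
    have 1: "D \<le> m * \<theta> - real h" "D \<le> real (k - h) - n * \<theta>"
      using hk kN by (auto simp: of_nat_diff)
    have "exp ((s + t) * D) \<le> exp (- s * (real h - m * \<theta>)) * exp (t * (real (k - h) - n * \<theta>))"
      using mult_left_mono[OF 1(1) s(1)] mult_left_mono[OF 1(2) t(1)]
      by (simp flip: exp_add add: algebra_simps)
    hence "real ((m choose h) * (n choose (k - h))) * c * exp ((s + t) * D)
       \<le> real ((m choose h) * (n choose (k - h))) * c *
          (exp (- s * (real h - m * \<theta>)) * exp (t * (real (k - h) - n * \<theta>)))"
      using c0 by (intro mult_left_mono) auto
    also have "\<dots> = a h * b (k - h)"
      unfolding c a_def b_def by (simp add: mult_ac)
    finally show ?thesis .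
  next
    case False
    hence "(m choose h) * (n choose (k - h)) = 0" by auto
    thus ?thesis using nn by (metis mult_nonneg_nonneg mult_zero_left of_nat_0)
  qed
  have "(\<Sum>h\<in>H. real ((m choose h) * (n choose (k - h)))) * c * exp ((s + t) * D)
     \<le> (\<Sum>h\<in>H. a h * b (k - h))"
    unfolding sum_distrib_right by (intro sum_mono summand)
  also have "\<dots> = (\<Sum>h\<in>H \<inter> {h. h \<le> m \<and> k - h \<le> n}. a h * b (k - h))"
    by (rule sum.mono_neutral_right[OF fin]) (auto simp: a_def b_def)
  \<comment> \<open>Dropping the constraint \<open>h + y = k\<close> makes the two tilted sums independent.\<close>
  also have "\<dots> = (\<Sum>(h, y)\<in>(\<lambda>h. (h, k - h)) ` (H \<inter> {h. h \<le> m \<and> k - h \<le> n}). a h * b y)"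
    by (subst sum.reindex) (auto simp: inj_on_def)
  also have "\<dots> \<le> (\<Sum>(h, y)\<in>{..m} \<times> {..n}. a h * b y)"
    using nn by (intro sum_mono2) auto
  also have "\<dots> = (\<Sum>h\<le>m. a h) * (\<Sum>y\<le>n. b y)"
    by (simp add: sum_product sum.cartesian_product)
  also have "\<dots> \<le> exp (m * (\<theta> * (1 - \<theta>) * s\<^sup>2 * (1 + s) / 2)) * exp (n * (\<theta> * (1 - \<theta>) * t\<^sup>2 * (1 + t) / 2))"
    using nn by (intro mult_mono sa sb sum_nonneg) auto
  also have "\<dots> = exp (\<theta> * (1 - \<theta>) * (m * s\<^sup>2 * (1 + s) + n * t\<^sup>2 * (1 + t)) / 2)"
    unfolding exp_add[symmetric] by (rule arg_cong[where f = exp]) (simp add: field_simps)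
  finally have main: "(\<Sum>h\<in>H. real ((m choose h) * (n choose (k - h)))) * c * exp ((s + t) * D)
     \<le> exp (\<theta> * (1 - \<theta>) * (m * s\<^sup>2 * (1 + s) + n * t\<^sup>2 * (1 + t)) / 2)"
    .
  define S where "S = (\<Sum>h\<in>H. real ((m choose h) * (n choose (k - h))))"
  define E where "E = exp (\<theta> * (1 - \<theta>) * (m * s\<^sup>2 * (1 + s) + n * t\<^sup>2 * (1 + t)) / 2)"
  have S0: "0 \<le> S" by (auto simp: S_def intro!: sum_nonneg)
  have "1 / (real N + 1) \<le> (N choose k) * c"
    using binomial_mode_lower_bound_real[of k N] k by (simp add: N_def c_def \<theta>_def mult.assoc)
  hence "1 \<le> (real N + 1) * (N choose k) * c"
    by (simp add: field_simps)
  hence "S * 1 \<le> S * ((real N + 1) * (N choose k) * c)"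
    using S0 by (intro mult_left_mono) auto
  also have "\<dots> = (real N + 1) * (N choose k) * exp (- (s + t) * D) * (S * c * exp ((s + t) * D))"
  proof -
    have "exp (- (s + t) * D) * exp ((s + t) * D) = 1"
      by (simp add: algebra_simps flip: exp_add)
    hence "S * ((real N + 1) * (N choose k) * c)
      = S * ((real N + 1) * (N choose k) * c) * (exp (- (s + t) * D) * exp ((s + t) * D))"
      by simp
    thus ?thesis by (simp only: ac_simps)
  qed
  also have "\<dots> \<le> (real N + 1) * (N choose k) * exp (- (s + t) * D) * E"
    using main unfolding S_def E_def by (intro mult_left_mono) auto
  also have "\<dots> = (real N + 1) * (N choose k) * exp (- (s + t) * D + \<theta> * (1 - \<theta>) * (m * s\<^sup>2 * (1 + s) + n * t\<^sup>2 * (1 + t)) / 2)"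
    unfolding E_def by (simp only: exp_add mult.assoc)
  finally show ?thesis by (simp add: S_def H_def N_def)
qed

text \<open>
  The two binomial lower bounds multiply. Their deviations from \<open>\<theta>\<close> are \<open>- D / m\<close> and \<open>D / n\<close>, so the
  exponents add up to \<open>D\<^sup>2 (1 / m + 1 / n)\<close>.
\<close>

lemma hypergeometric_prob_ge:
  fixes m n k h :: nat and D \<theta> \<epsilon> :: real
  defines "\<theta> \<equiv> real k / real (m + n)" and "D \<equiv> m * \<theta> - real h"
  assumes k: "0 < k" "k < m + n" and mn: "0 < m" "0 < n" and eps: "\<epsilon> < 1"
    and D: "\<bar>D\<bar> \<le> \<epsilon> * (m * \<theta> * (1 - \<theta>))" "\<bar>D\<bar> \<le> \<epsilon> * (n * \<theta> * (1 - \<theta>))"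
  shows "h \<le> k"
    and "exp (- (D\<^sup>2 * (1 / m + 1 / n) * (1 + \<epsilon>) / (2 * \<theta> * (1 - \<theta>))))
          / ((real m + 1) * (real n + 1)) * ((m + n) choose k)
         \<le> real ((m choose h) * (n choose (k - h)))"
proof -
  define N where "N = m + n"
  have th: "0 < \<theta>" "\<theta> < 1" using k by (auto simp: \<theta>_def)
  have "real k = real (m + n) * \<theta>" using k by (simp add: \<theta>_def)
  hence kN: "real k = m * \<theta> + n * \<theta>" by (simp add: distrib_right)
  have pos: "0 < \<theta> * (1 - \<theta>)" using th by simp
  have "0 \<le> \<epsilon>"
  proof -
    have "0 \<le> \<epsilon> * (m * \<theta> * (1 - \<theta>))" using D(1) by linarith
    moreover have "0 < m * \<theta> * (1 - \<theta>)" using th mn by simp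
    ultimately show ?thesis by (metis mult_neg_pos not_le)
  qed
  have small: "\<bar>D\<bar> \<le> n * \<theta>" "\<bar>D\<bar> \<le> n * (1 - \<theta>)" "\<bar>D\<bar> \<le> m * \<theta>" "\<bar>D\<bar> \<le> m * (1 - \<theta>)"
  proof -
    have a: "\<epsilon> * (a * \<theta> * (1 - \<theta>)) \<le> a * \<theta>" "\<epsilon> * (a * \<theta> * (1 - \<theta>)) \<le> a * (1 - \<theta>)" if "0 \<le> a" for a
    proof -
      have "(a * \<theta>) * (\<epsilon> * (1 - \<theta>)) \<le> (a * \<theta>) * 1" "(a * (1 - \<theta>)) * (\<epsilon> * \<theta>) \<le> (a * (1 - \<theta>)) * 1"
        using that th eps \<open>0 \<le> \<epsilon>\<close> by (intro mult_left_mono mult_le_one; simp)+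
      thus "\<epsilon> * (a * \<theta> * (1 - \<theta>)) \<le> a * \<theta>" "\<epsilon> * (a * \<theta> * (1 - \<theta>)) \<le> a * (1 - \<theta>)"
        by (auto simp: mult_ac)
    qed
    show "\<bar>D\<bar> \<le> n * \<theta>" "\<bar>D\<bar> \<le> n * (1 - \<theta>)" "\<bar>D\<bar> \<le> m * \<theta>" "\<bar>D\<bar> \<le> m * (1 - \<theta>)"
      using D a[of m] a[of n] by linarith+
  qed
  have "real h \<le> real k" using small D_def kN by linarith
  thus hk: "h \<le> k" by simp
  have "real h \<le> real m" using small(4) D_def th by (simp add: algebra_simps)
  hence hm: "h \<le> m" by simp
  have "real k - real h \<le> real n" using small(2) D_def kN th by (simp add: algebra_simps)
  hence kn: "k - h \<le> n" using hk by simp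
  have e1: "h / m - \<theta> = - D / m" using mn by (simp add: D_def field_simps)
  have e2: "(k - h) / n - \<theta> = D / n" using mn kN hk by (simp add: D_def field_simps of_nat_diff)
  have 1: "exp (- (m * (h / m - \<theta>)\<^sup>2 * (1 + \<epsilon>) / (2 * \<theta> * (1 - \<theta>)))) / (real m + 1)
         \<le> (m choose h) * \<theta> ^ h * (1 - \<theta>) ^ (m - h)"
  proof (rule binomial_prob_ge)
    show "\<bar>h / m - \<theta>\<bar> \<le> \<epsilon> * (\<theta> * (1 - \<theta>))"
      unfolding e1 using D(1) mn by (simp add: field_simps)
  qed (use th mn eps in auto)
  have 2: "exp (- (n * ((k - h) / n - \<theta>)\<^sup>2 * (1 + \<epsilon>) / (2 * \<theta> * (1 - \<theta>)))) / (real n + 1)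
         \<le> (n choose (k - h)) * \<theta> ^ (k - h) * (1 - \<theta>) ^ (n - (k - h))"
  proof (rule binomial_prob_ge)
    show "\<bar>(k - h) / n - \<theta>\<bar> \<le> \<epsilon> * (\<theta> * (1 - \<theta>))"
      unfolding e2 using D(2) mn by (simp add: field_simps)
  qed (use th mn eps in auto)
  define E where "E = exp (- (D\<^sup>2 * (1 / m + 1 / n) * (1 + \<epsilon>) / (2 * \<theta> * (1 - \<theta>))))"
  define c where "c = \<theta> ^ k * (1 - \<theta>) ^ (N - k)"
  have c0: "0 < c" using th by (simp add: c_def)
  have c: "c = \<theta> ^ h * (1 - \<theta>) ^ (m - h) * (\<theta> ^ (k - h) * (1 - \<theta>) ^ (n - (k - h)))"
  proof -
    have "\<theta> ^ k = \<theta> ^ h * \<theta> ^ (k - h)" using hk by (simp flip: power_add)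
    moreover have "N - k = (m - h) + (n - (k - h))" using hm kn hk by (simp add: N_def)
    ultimately show ?thesis by (simp add: c_def power_add)
  qed
  have "E = exp (- (m * (h / m - \<theta>)\<^sup>2 * (1 + \<epsilon>) / (2 * \<theta> * (1 - \<theta>))))
           * exp (- (n * ((k - h) / n - \<theta>)\<^sup>2 * (1 + \<epsilon>) / (2 * \<theta> * (1 - \<theta>))))"
  proof -
    have "D\<^sup>2 * (1 / m + 1 / n) = m * (h / m - \<theta>)\<^sup>2 + n * ((k - h) / n - \<theta>)\<^sup>2"
      unfolding e1 e2 using mn by (simp add: power_divide power2_eq_square distrib_left)
    thus ?thesis unfolding E_def
      by (simp add: distrib_right add_divide_distrib flip: exp_add)
  qed
  hence "E / ((real m + 1) * (real n + 1))
      \<le> ((m choose h) * \<theta> ^ h * (1 - \<theta>) ^ (m - h)) * ((n choose (k - h)) * \<theta> ^ (k - h) * (1 - \<theta>) ^ (n - (k - h)))"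
    using mult_mono[OF 1 2] th by simp
  also have "\<dots> = real ((m choose h) * (n choose (k - h))) * c"
    unfolding c by (simp add: mult_ac)
  finally have 3: "E / ((real m + 1) * (real n + 1)) \<le> real ((m choose h) * (n choose (k - h))) * c" .
  have "(N choose k) * c \<le> 1"
    using binomial_prob_le_1[of \<theta> k N] th k by (simp add: N_def c_def mult.assoc)
  hence "E / ((real m + 1) * (real n + 1)) * ((N choose k) * c) \<le> E / ((real m + 1) * (real n + 1)) * 1"
    by (intro mult_left_mono) (auto simp: E_def)
  also note 3
  finally have "c * (E / ((real m + 1) * (real n + 1)) * (N choose k)) \<le> c * real ((m choose h) * (n choose (k - h)))"
    by (simp add: mult_ac)
  thus "E / ((real m + 1) * (real n + 1)) * ((m + n) choose k)
         \<le> real ((m choose h) * (n choose (k - h)))"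
    using c0 unfolding N_def by (rule mult_left_le_imp_le)
qed

text \<open>
  The tilts are those that would be optimal for Gaussian variables, \<open>s = D / (m v)\<close> and
  \<open>t = D / (n v)\<close>. The hypotheses \<open>small\<close> say precisely that both are at most \<open>\<epsilon>\<close>.
\<close>

lemma hypergeometric_tail_le_gaussian:
  fixes m n k :: nat and D \<epsilon> \<theta> v :: real
  defines "\<theta> \<equiv> real k / real (m + n)" and "v \<equiv> \<theta> * (1 - \<theta>)"
  assumes k: "0 < k" "k < m + n" and mn: "0 < m" "0 < n" and D: "0 \<le> D" and eps: "\<epsilon> \<le> 1"
    and small: "D \<le> \<epsilon> * (m * v)" "D \<le> \<epsilon> * (n * v)"
  shows "(\<Sum>h | h \<le> k \<and> real h \<le> m * \<theta> - D. real ((m choose h) * (n choose (k - h)))) / ((m + n) choose k)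
       \<le> (real (m + n) + 1) * exp (- ((1 - \<epsilon>) * (D\<^sup>2 * (1 / m + 1 / n)) / (2 * v)))"
proof -
  have v: "0 < v" using k by (auto simp: v_def \<theta>_def)
  define s t where "s = D / (m * v)" and "t = D / (n * v)"
  have st: "0 \<le> s" "0 \<le> t" "s \<le> \<epsilon>" "t \<le> \<epsilon>"
    using D v mn small by (auto simp: s_def t_def pos_divide_le_eq)
  have ms: "v * (m * s\<^sup>2) = s * D" "v * (n * t\<^sup>2) = t * D"
    using v mn by (auto simp: s_def t_def power2_eq_square)
  have sum: "(s + t) * D = D\<^sup>2 * (1 / m + 1 / n) / v"
    using v mn by (simp add: s_def t_def power2_eq_square field_simps)
  have "- (s + t) * D + v * (m * s\<^sup>2 * (1 + s) + n * t\<^sup>2 * (1 + t)) / 2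
      = - (s + t) * D + (v * (m * s\<^sup>2) * (1 + s) + v * (n * t\<^sup>2) * (1 + t)) / 2"
    by (simp add: algebra_simps)
  also have "\<dots> = - (s * D * (1 - s) + t * D * (1 - t)) / 2"
    unfolding ms by (simp add: field_simps)
  also have "\<dots> \<le> - (s * D * (1 - \<epsilon>) + t * D * (1 - \<epsilon>)) / 2"
  proof -
    have "s * D * (1 - \<epsilon>) \<le> s * D * (1 - s)" "t * D * (1 - \<epsilon>) \<le> t * D * (1 - t)"
      using st D by (auto intro!: mult_left_mono)
    thus ?thesis by simp
  qed
  also have "\<dots> = - ((1 - \<epsilon>) * ((s + t) * D) / 2)" by (simp add: field_simps)
  also have "\<dots> = - ((1 - \<epsilon>) * (D\<^sup>2 * (1 / m + 1 / n)) / (2 * v))" unfolding sum by simp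
  finally have exponent: "- (s + t) * D + v * (m * s\<^sup>2 * (1 + s) + n * t\<^sup>2 * (1 + t)) / 2
      \<le> - ((1 - \<epsilon>) * (D\<^sup>2 * (1 / m + 1 / n)) / (2 * v))" .
  have "(\<Sum>h | h \<le> k \<and> real h \<le> m * \<theta> - D. real ((m choose h) * (n choose (k - h))))
     \<le> (real (m + n) + 1) * ((m + n) choose k)
         * exp (- (s + t) * D + v * (m * s\<^sup>2 * (1 + s) + n * t\<^sup>2 * (1 + t)) / 2)"
    unfolding \<theta>_def v_def by (rule hypergeometric_tail_le) (use k mn st eps in auto)
  also have "\<dots> \<le> (real (m + n) + 1) * ((m + n) choose k)
         * exp (- ((1 - \<epsilon>) * (D\<^sup>2 * (1 / m + 1 / n)) / (2 * v)))"
    using exponent by (intro mult_left_mono) auto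
  finally show ?thesis using k by (simp add: pos_divide_le_eq mult_ac)
qed

text \<open>
  Only the term with the largest admissible integer \<open>h\<close> is kept; rounding \<open>m \<theta> - D\<close> down to an integer
  is what turns \<open>D\<close> into \<open>D + 1\<close>.
\<close>

lemma hypergeometric_tail_ge_gaussian:
  fixes m n k :: nat and D \<epsilon> \<theta> v :: real
  defines "\<theta> \<equiv> real k / real (m + n)" and "v \<equiv> \<theta> * (1 - \<theta>)"
  assumes k: "0 < k" "k < m + n" and mn: "0 < m" "0 < n" and D: "0 \<le> D" and eps: "\<epsilon> < 1"
    and small: "D + 1 \<le> \<epsilon> * (m * v)" "D + 1 \<le> \<epsilon> * (n * v)"
  shows "exp (- ((1 + \<epsilon>) * ((D + 1)\<^sup>2 * (1 / m + 1 / n)) / (2 * v))) / (real (m + n) + 1)\<^sup>2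
    \<le> (\<Sum>h | h \<le> k \<and> real h \<le> m * \<theta> - D. real ((m choose h) * (n choose (k - h)))) / ((m + n) choose k)"
proof -
  have th: "0 < \<theta>" "\<theta> < 1" using k by (auto simp: \<theta>_def)
  hence v: "0 < v" by (auto simp: v_def)
  have eps0: "0 < \<epsilon>"
  proof -
    have "0 < \<epsilon> * (m * v)" using small(1) D by linarith
    moreover have "0 < m * v" using mn v by simp
    ultimately show ?thesis by (simp add: zero_less_mult_iff)
  qed
  define h where "h = nat \<lfloor>m * \<theta> - D\<rfloor>"
  define D' where "D' = m * \<theta> - real h"
  have "v \<le> \<theta>" using th by (simp add: v_def mult_left_le)
  have "\<epsilon> * (m * v) \<le> 1 * (m * v)" using eps v by (intro mult_right_mono) auto
  also have "\<dots> \<le> m * \<theta>" using \<open>v \<le> \<theta>\<close> by (simp add: mult_left_mono)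
  finally have "0 \<le> m * \<theta> - D" using small(1) by linarith
  hence h: "real h = of_int \<lfloor>m * \<theta> - D\<rfloor>" by (simp add: h_def)
  have D': "D \<le> D'" "D' \<le> D + 1" unfolding D'_def h by linarith+
  have abs: "\<bar>D'\<bar> \<le> \<epsilon> * (m * \<theta> * (1 - \<theta>))" "\<bar>D'\<bar> \<le> \<epsilon> * (n * \<theta> * (1 - \<theta>))"
    using D D' small by (auto simp: v_def mult.assoc)
  note pmf = hypergeometric_prob_ge[OF k mn eps abs[unfolded D'_def \<theta>_def], folded \<theta>_def, folded D'_def]
  let ?E = "exp (- ((1 + \<epsilon>) * ((D + 1)\<^sup>2 * (1 / m + 1 / n)) / (2 * v)))"
  have "(D')\<^sup>2 * (1 / m + 1 / n) * (1 + \<epsilon>) / (2 * \<theta> * (1 - \<theta>))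
     \<le> (D + 1)\<^sup>2 * (1 / m + 1 / n) * (1 + \<epsilon>) / (2 * \<theta> * (1 - \<theta>))"
    using D D' th eps0 by (intro divide_right_mono mult_right_mono power_mono) auto
  also have "\<dots> = (1 + \<epsilon>) * ((D + 1)\<^sup>2 * (1 / m + 1 / n)) / (2 * v)"
    by (simp add: v_def mult_ac)
  finally have 1: "?E \<le> exp (- ((D')\<^sup>2 * (1 / m + 1 / n) * (1 + \<epsilon>) / (2 * \<theta> * (1 - \<theta>))))" by simp
  have 2: "(real m + 1) * (real n + 1) \<le> (real (m + n) + 1)\<^sup>2"
    unfolding power2_eq_square by (intro mult_mono) auto
  have "?E / (real (m + n) + 1)\<^sup>2 * ((m + n) choose k)
     \<le> exp (- ((D')\<^sup>2 * (1 / m + 1 / n) * (1 + \<epsilon>) / (2 * \<theta> * (1 - \<theta>)))) / ((real m + 1) * (real n + 1)) * ((m + n) choose k)"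
    using 1 2 by (intro mult_right_mono frac_le) auto
  also have "\<dots> \<le> real ((m choose h) * (n choose (k - h)))" by (rule pmf(2))
  also have "\<dots> \<le> (\<Sum>h | h \<le> k \<and> real h \<le> m * \<theta> - D. real ((m choose h) * (n choose (k - h))))"
  proof (rule member_le_sum)
    show "h \<in> {h. h \<le> k \<and> real h \<le> m * \<theta> - D}" using pmf(1) D'(1) by (simp add: D'_def)
    show "finite {h. h \<le> k \<and> real h \<le> m * \<theta> - D}" by (rule finite_subset[of _ "{..k}"]) auto
  qed auto
  finally show ?thesis using k by (simp add: pos_le_divide_eq)
qed


section \<open>Exchangeability and the set of lowest ranks\<close>

definition low_ranked :: "nat \<Rightarrow> nat \<Rightarrow> (nat \<Rightarrow> real) \<Rightarrow> nat set" where
  "low_ranked N k z = {i \<in> {1..N}. pooled_rank N z i \<le> k}"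

lemma low_ranked_subset: "low_ranked N k z \<subseteq> {1..N}"
  by (auto simp: low_ranked_def)

lemma pooled_rank_bounds:
  assumes "i \<in> {1..N}"
  shows "1 \<le> pooled_rank N z i" "pooled_rank N z i \<le> N"
proof -
  have "card {i} \<le> pooled_rank N z i"
    unfolding pooled_rank_def using assms by (intro card_mono) auto
  thus "1 \<le> pooled_rank N z i" by simp
  have "pooled_rank N z i \<le> card {1..N}"
    unfolding pooled_rank_def by (intro card_mono) auto
  thus "pooled_rank N z i \<le> N" by simp
qed

lemma bij_betw_pooled_rank:
  assumes "inj_on z {1..N}"
  shows "bij_betw (pooled_rank N z) {1..N} {1..N}"
proof -
  have less: "pooled_rank N z i < pooled_rank N z j"
    if "i \<in> {1..N}" "j \<in> {1..N}" "z i < z j" for i j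
    unfolding pooled_rank_def
  proof (rule psubset_card_mono)
    show "{l \<in> {1..N}. z l \<le> z i} \<subset> {l \<in> {1..N}. z l \<le> z j}" 
    proof
      show "{l \<in> {1..N}. z l \<le> z i} \<subseteq> {l \<in> {1..N}. z l \<le> z j}" using that(3) by auto
      have "j \<in> {l \<in> {1..N}. z l \<le> z j}" "j \<notin> {l \<in> {1..N}. z l \<le> z i}" using that by auto
      thus "{l \<in> {1..N}. z l \<le> z i} \<noteq> {l \<in> {1..N}. z l \<le> z j}" by blast
    qed
  qed auto
  have inj: "inj_on (pooled_rank N z) {1..N}"
  proof (rule inj_onI)
    fix i j assume ij: "i \<in> {1..N}" "j \<in> {1..N}" "pooled_rank N z i = pooled_rank N z j"
    hence "z i = z j" using less[of i j] less[of j i] by (cases "z i" "z j" rule: linorder_cases) auto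
    thus "i = j" using assms ij by (auto dest: inj_onD)
  qed
  have "pooled_rank N z ` {1..N} \<subseteq> {1..N}" using pooled_rank_bounds by auto
  hence "pooled_rank N z ` {1..N} = {1..N}" using inj by (intro endo_inj_surj) auto
  with inj show ?thesis by (simp add: bij_betw_def)
qed

lemma card_low_ranked:
  assumes "inj_on z {1..N}" "k \<le> N"
  shows "card (low_ranked N k z) = k"
proof -
  have bij: "bij_betw (pooled_rank N z) {1..N} {1..N}" by (rule bij_betw_pooled_rank[OF assms(1)])
  have "pooled_rank N z ` low_ranked N k z = {1..k}"
  proof
    show "pooled_rank N z ` low_ranked N k z \<subseteq> {1..k}"
      using pooled_rank_bounds by (auto simp: low_ranked_def)
    show "{1..k} \<subseteq> pooled_rank N z ` low_ranked N k z"
    proof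
      fix r assume r: "r \<in> {1..k}"
      hence "r \<in> pooled_rank N z ` {1..N}" using bij assms(2) by (simp add: bij_betw_def)
      thus "r \<in> pooled_rank N z ` low_ranked N k z" using r by (auto simp: low_ranked_def)
    qed
  qed
  moreover have "inj_on (pooled_rank N z) (low_ranked N k z)"
    by (rule inj_on_subset[OF bij_betw_imp_inj_on[OF bij] low_ranked_subset])
  ultimately have "card (low_ranked N k z) = card {1..k}" by (metis card_image)
  thus ?thesis by simp
qed

lemma borel_measurable_pooled_rank:
  assumes [measurable_cong]: "sets P = sets borel" and i: "i \<in> {1..N}"
  shows "(\<lambda>z. real (pooled_rank N z i)) \<in> borel_measurable (PiM {1..N} (\<lambda>_. P))"
proof -
  have eq: "real (pooled_rank N z i) = (\<Sum>l\<in>{1..N}. if z l \<le> z i then 1 else 0)" for z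
    by (simp add: pooled_rank_def sum.If_cases Int_def)
  have "(\<lambda>z. z l) \<in> borel_measurable (PiM {1..N} (\<lambda>_. P))" if "l \<in> {1..N}" for l
    using measurable_component_singleton[OF that, of "\<lambda>_. P"] assms(1) measurable_cong_sets by blast
  note [measurable] = this this[OF i]
  show ?thesis unfolding eq by measurable
qed

lemma borel_measurable_ell [measurable]: "ell p \<in> borel_measurable borel"
  unfolding ell_def by measurable

lemma borel_measurable_rank_stat:
  assumes "sets P = sets borel"
  shows "rank_stat m n p \<in> borel_measurable (PiM {1..m + n} (\<lambda>_. P))"
proof -
  have "(\<lambda>z. real (pooled_rank (m + n) z i)) \<in> borel_measurable (PiM {1..m + n} (\<lambda>_. P))" if "i \<in> {1..m + n}" for i
    by (rule borel_measurable_pooled_rank[OF assms that])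
  note [measurable] = this
  show ?thesis unfolding rank_stat_def[abs_def] by measurable
qed

text \<open>
  Arbitrary \<open>Q\<close> is allowed because the random set takes only finitely many values.
\<close>

lemma low_ranked_event_measurable:
  assumes "sets P = sets borel"
  shows "{z \<in> space (PiM {1..N} (\<lambda>_. P)). Q (low_ranked N k z)} \<in> sets (PiM {1..N} (\<lambda>_. P))"
proof -
  let ?M = "PiM {1..N} (\<lambda>_. P)"
  have *: "{z \<in> space ?M. low_ranked N k z = A} \<in> sets ?M" if "A \<subseteq> {1..N}" for A
  proof -
    have [measurable]: "(\<lambda>z. real (pooled_rank N z i)) \<in> borel_measurable ?M" if "i \<in> {1..N}" for i
      by (rule borel_measurable_pooled_rank[OF assms that])
    have "{z \<in> space ?M. low_ranked N k z = A}
        = {z \<in> space ?M. \<forall>i\<in>{1..N}. (real (pooled_rank N z i) \<le> real k) = (i \<in> A)}"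
      using that by (auto simp: low_ranked_def)
    also have "\<dots> \<in> sets ?M" by measurable
    finally show ?thesis .
  qed
  have "{z \<in> space ?M. Q (low_ranked N k z)} = (\<Union>A\<in>{A. A \<subseteq> {1..N} \<and> Q A}. {z \<in> space ?M. low_ranked N k z = A})"
    using low_ranked_subset by auto
  also have "\<dots> \<in> sets ?M"
  proof (intro sets.finite_UN)
    show "finite {A. A \<subseteq> {1..N} \<and> Q A}" by (rule finite_subset[of _ "Pow {1..N}"]) auto
  qed (use * in blast)
  finally show ?thesis .
qed

text \<open>
  Two coordinates are independent, so their joint law is a product of atomless measures, and the
  diagonal is null by Fubini.
\<close>

lemma AE_PiM_inj_on:
  fixes P :: "real measure"
  assumes "prob_space P" and P: "sets P = sets borel" and atomless: "\<And>x. measure P {x} = 0"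
    and fin: "finite I"
  shows "AE z in PiM I (\<lambda>_. P). inj_on z I"
proof -
  interpret P: prob_space P by fact
  interpret Q: prob_space "PiM I (\<lambda>_. P)" by (rule prob_space_PiM) (rule assms(1))
  interpret PP: pair_prob_space P P by unfold_locales
  note P[measurable_cong]
  have ne: "AE z in PiM I (\<lambda>_. P). z i \<noteq> z j" if ij: "i \<in> I" "j \<in> I" "i \<noteq> j" for i j
  proof -
    have "Q.indep_vars (\<lambda>_. P) (\<lambda>i z. z i) I"
    proof (subst Q.indep_vars_iff_distr_eq_PiM')
      show "distr (PiM I (\<lambda>_. P)) (PiM I (\<lambda>_. P)) (\<lambda>x. \<lambda>i\<in>I. x i) = PiM I (\<lambda>i. distr (PiM I (\<lambda>_. P)) P (\<lambda>z. z i))"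
      proof -
        have "distr (PiM I (\<lambda>_. P)) (PiM I (\<lambda>_. P)) (\<lambda>x. \<lambda>i\<in>I. x i) = distr (PiM I (\<lambda>_. P)) (PiM I (\<lambda>_. P)) (\<lambda>x. x)"
          by (rule distr_cong) (auto simp: space_PiM)
        moreover have "PiM I (\<lambda>i. distr (PiM I (\<lambda>_. P)) P (\<lambda>z. z i)) = PiM I (\<lambda>_. P)"
          using assms(1) by (intro PiM_cong refl distr_PiM_component) auto
        ultimately show ?thesis by (simp add: distr_id2)
      qed
    qed (use ij in auto)
    hence "Q.indep_var (PiM {i} (\<lambda>_. P)) (\<lambda>z. restrict (\<lambda>l. z l) {i}) (PiM {j} (\<lambda>_. P)) (\<lambda>z. restrict (\<lambda>l. z l) {j})"
      using ij by (intro Q.indep_var_restrict) auto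
    hence "Q.indep_var P ((\<lambda>x. x i) \<circ> (\<lambda>z. restrict (\<lambda>l. z l) {i})) P ((\<lambda>x. x j) \<circ> (\<lambda>z. restrict (\<lambda>l. z l) {j}))"
      by (rule Q.indep_var_compose) auto
    hence "Q.indep_var P (\<lambda>z. z i) P (\<lambda>z. z j)"
      by (simp add: comp_def)
    hence eq: "P \<Otimes>\<^sub>M P = distr (PiM I (\<lambda>_. P)) (P \<Otimes>\<^sub>M P) (\<lambda>z. (z i, z j))"
      unfolding Q.indep_var_distribution_eq using ij distr_PiM_component[of I "\<lambda>_. P"] assms(1) by simp
    have "AE x in P. AE y in P. x \<noteq> y"
    proof (rule AE_I2)
      fix x
      have "{x} \<in> null_sets P"
        using atomless[of x] P by (auto simp: null_sets_def P.emeasure_eq_measure)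
      hence "AE y in P. y \<notin> {x}" by (rule AE_not_in)
      thus "AE y in P. x \<noteq> y" by eventually_elim auto
    qed
    hence "AE xy in P \<Otimes>\<^sub>M P. fst xy \<noteq> snd xy"
      by (subst PP.AE_pair_iff[symmetric]) auto
    hence "AE xy in distr (PiM I (\<lambda>_. P)) (P \<Otimes>\<^sub>M P) (\<lambda>z. (z i, z j)). fst xy \<noteq> snd xy"
      by (subst eq[symmetric])
    thus ?thesis
      using ij by (auto dest!: AE_distrD[rotated])
  qed
  have "AE z in PiM I (\<lambda>_. P). \<forall>i\<in>I. \<forall>j\<in>I. i \<noteq> j \<longrightarrow> z i \<noteq> z j"
    using fin ne by (intro AE_finite_allI) auto
  thus ?thesis by eventually_elim (auto simp: inj_on_def)
qed

text \<open>
  Exchangeability: a permutation of the indices that carries \<open>A\<close> to \<open>B\<close> preserves the product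
  measure and permutes the set of lowest ranks accordingly.
\<close>

lemma measure_low_ranked_eq:
  fixes P :: "real measure"
  assumes ps: "prob_space P" and P: "sets P = sets borel"
    and A: "A \<subseteq> {1..N}" and B: "B \<subseteq> {1..N}" and card: "card A = card B"
  shows "measure (PiM {1..N} (\<lambda>_. P)) {z \<in> space (PiM {1..N} (\<lambda>_. P)). low_ranked N k z = A}
       = measure (PiM {1..N} (\<lambda>_. P)) {z \<in> space (PiM {1..N} (\<lambda>_. P)). low_ranked N k z = B}"
proof -
  let ?I = "{1..N}" and ?M = "PiM {1..N} (\<lambda>_. P)"
  have fin: "finite A" "finite B" using A B by (auto intro: finite_subset)
  obtain f where f: "bij_betw f A B" using finite_same_card_bij[OF fin card] by blast
  have "card (?I - A) = card (?I - B)" using A B fin card by (simp add: card_Diff_subset)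
  then obtain g where g: "bij_betw g (?I - A) (?I - B)"
    using finite_same_card_bij[of "?I - A" "?I - B"] by auto
  define \<sigma> where "\<sigma> i = (if i \<in> A then f i else g i)" for i
  have 1: "bij_betw \<sigma> A B" using f by (subst bij_betw_cong[of _ _ f]) (auto simp: \<sigma>_def)
  have 2: "bij_betw \<sigma> (?I - A) (?I - B)" using g by (subst bij_betw_cong[of _ _ g]) (auto simp: \<sigma>_def)
  have \<sigma>: "bij_betw \<sigma> ?I ?I"
    using bij_betw_combine[OF 1 2] A B by (simp add: Un_absorb1)
  have \<sigma>B: "\<sigma> i \<in> B \<longleftrightarrow> i \<in> A" if "i \<in> ?I" for i
  proof (cases "i \<in> A")
    case True
    thus ?thesis using bij_betwE[OF 1] by simp
  next
    case False
    hence "\<sigma> i \<in> ?I - B" using bij_betwE[OF 2] that by simp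
    thus ?thesis using False by simp
  qed
  define T where "T z = (\<lambda>i\<in>?I. z (\<sigma> i))" for z :: "nat \<Rightarrow> real"
  have distr: "distr ?M ?M T = ?M"
    unfolding T_def using \<sigma> ps
    by (intro distr_PiM_reindex) (auto simp: bij_betw_def)
  have T: "T \<in> measurable ?M ?M"
    unfolding T_def using \<sigma> by (intro measurable_restrict measurable_component_singleton) (auto simp: bij_betw_def)
  have rank: "pooled_rank N (T z) i = pooled_rank N z (\<sigma> i)" if "i \<in> ?I" for z i
  proof -
    have "bij_betw \<sigma> {l \<in> ?I. T z l \<le> T z i} {l \<in> ?I. z l \<le> z (\<sigma> i)}"
    proof (rule bij_betw_subset[OF \<sigma>])
      have im: "\<sigma> ` ?I = ?I" using \<sigma> by (rule bij_betw_imp_surj_on)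
      have "{l \<in> ?I. T z l \<le> T z i} = {l \<in> ?I. z (\<sigma> l) \<le> z (\<sigma> i)}"
        using that by (auto simp: T_def)
      also have "\<sigma> ` \<dots> = {l \<in> \<sigma> ` ?I. z l \<le> z (\<sigma> i)}" by blast
      finally show "\<sigma> ` {l \<in> ?I. T z l \<le> T z i} = {l \<in> ?I. z l \<le> z (\<sigma> i)}"
        unfolding im .
    qed auto
    thus ?thesis unfolding pooled_rank_def by (rule bij_betw_same_card)
  qed
  have low: "low_ranked N k (T z) = A \<longleftrightarrow> low_ranked N k z = B" for z
  proof -
    have "low_ranked N k (T z) = {i \<in> ?I. \<sigma> i \<in> low_ranked N k z}"
      using \<sigma> rank by (auto simp: low_ranked_def bij_betw_def)
    moreover have "{i \<in> ?I. \<sigma> i \<in> low_ranked N k z} = A \<longleftrightarrow> low_ranked N k z = B"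
    proof
      assume *: "{i \<in> ?I. \<sigma> i \<in> low_ranked N k z} = A"
      have "\<sigma> ` {i \<in> ?I. \<sigma> i \<in> low_ranked N k z} = low_ranked N k z"
      proof -
        have "\<sigma> ` {i \<in> ?I. \<sigma> i \<in> low_ranked N k z} = {j \<in> \<sigma> ` ?I. j \<in> low_ranked N k z}" by blast
        also have "\<dots> = low_ranked N k z"
          unfolding bij_betw_imp_surj_on[OF \<sigma>] using low_ranked_subset by blast
        finally show ?thesis .
      qed
      thus "low_ranked N k z = B" using * 1 by (simp add: bij_betw_def)
    next
      assume "low_ranked N k z = B"
      thus "{i \<in> ?I. \<sigma> i \<in> low_ranked N k z} = A" using \<sigma>B A by auto
    qed
    ultimately show ?thesis by simp
  qed
  have "measure ?M {z \<in> space ?M. low_ranked N k z = A} = measure (distr ?M ?M T) {z \<in> space ?M. low_ranked N k z = A}"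
    by (simp only: distr)
  also have "\<dots> = measure ?M (T -` {z \<in> space ?M. low_ranked N k z = A} \<inter> space ?M)"
    using T low_ranked_event_measurable[OF P] by (rule measure_distr)
  also have "T -` {z \<in> space ?M. low_ranked N k z = A} \<inter> space ?M = {z \<in> space ?M. low_ranked N k z = B}"
    using low measurable_space[OF T] by auto
  finally show ?thesis .
qed

text \<open>
  Without ties the random set has exactly \<open>k\<close> elements. By exchangeability all \<open>k\<close>-subsets are equally
  likely, so it is uniform on them.
\<close>

lemma measure_low_ranked_event:
  fixes P :: "real measure"
  assumes ps: "prob_space P" and P: "sets P = sets borel" and atomless: "\<And>x. measure P {x} = 0"
    and k: "k \<le> N"
  shows "measure (PiM {1..N} (\<lambda>_. P)) {z \<in> space (PiM {1..N} (\<lambda>_. P)). Q (low_ranked N k z)}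
       = real (card {A. A \<subseteq> {1..N} \<and> card A = k \<and> Q A}) / (N choose k)"
proof -
  let ?I = "{1..N}" and ?M = "PiM {1..N} (\<lambda>_. P)"
  interpret prob_space ?M by (rule prob_space_PiM) (rule ps)
  define p where "p = prob {z \<in> space ?M. low_ranked N k z = {1..k}}"
  have p: "prob {z \<in> space ?M. low_ranked N k z = A} = p" if "A \<subseteq> ?I" "card A = k" for A
    unfolding p_def using that k by (intro measure_low_ranked_eq ps P) auto
  have *: "prob {z \<in> space ?M. R (low_ranked N k z)} = card {A. A \<subseteq> ?I \<and> card A = k \<and> R A} * p" for R
  proof -
    let ?F = "{A. A \<subseteq> ?I \<and> card A = k \<and> R A}"
    have fin: "finite ?F" by (rule finite_subset[of _ "Pow ?I"]) auto
    have "prob {z \<in> space ?M. R (low_ranked N k z)} = prob {z \<in> space ?M. low_ranked N k z \<in> ?F}"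
    proof (rule finite_measure_eq_AE)
      show "AE z in ?M. (z \<in> {z \<in> space ?M. R (low_ranked N k z)}) = (z \<in> {z \<in> space ?M. low_ranked N k z \<in> ?F})"
        using AE_PiM_inj_on[OF ps P atomless, of ?I, simplified]
        by eventually_elim (use card_low_ranked[OF _ k] low_ranked_subset in auto)
    qed (use low_ranked_event_measurable[OF P] in auto)
    also have "{z \<in> space ?M. low_ranked N k z \<in> ?F} = (\<Union>A\<in>?F. {z \<in> space ?M. low_ranked N k z = A})"
      by auto
    also have "prob \<dots> = (\<Sum>A\<in>?F. prob {z \<in> space ?M. low_ranked N k z = A})"
      using fin low_ranked_event_measurable[OF P]
      by (intro finite_measure_finite_Union) (auto simp: disjoint_family_on_def)
    also have "\<dots> = card ?F * p" using p by simp
    finally show ?thesis .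
  qed
  have "1 = (N choose k) * p"
    using *[of "\<lambda>_. True"] n_subsets[of ?I k] prob_space by simp
  hence "p = 1 / (N choose k)" using k by (simp add: field_simps)
  thus ?thesis using *[of Q] by simp
qed


section \<open>Two-valued rank statistics as hypergeometric counts\<close>

text \<open>Hypergeometric counting: the two parts of the subset are chosen independently.\<close>

lemma card_subsets_split:
  fixes m n k h :: nat
  assumes "h \<le> k"
  shows "card {A. A \<subseteq> {1..m + n} \<and> card A = k \<and> card (A \<inter> {1..m}) = h} = (m choose h) * (n choose (k - h))"
proof -
  let ?X = "{X. X \<subseteq> {1..m} \<and> card X = h}" and ?Y = "{Y. Y \<subseteq> {m+1..m+n} \<and> card Y = k - h}"
  have disj: "{1..m} \<inter> {m+1..m+n} = {}" and un: "{1..m} \<union> {m+1..m+n} = {1..m+n}" by auto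
  have "bij_betw (\<lambda>(X, Y). X \<union> Y) (?X \<times> ?Y) {A. A \<subseteq> {1..m + n} \<and> card A = k \<and> card (A \<inter> {1..m}) = h}"
  proof (rule bij_betw_byWitness[where f' = "\<lambda>A. (A \<inter> {1..m}, A \<inter> {m+1..m+n})"])
    show "\<forall>a\<in>?X \<times> ?Y. (\<lambda>A. (A \<inter> {1..m}, A \<inter> {m+1..m+n})) (case a of (X, Y) \<Rightarrow> X \<union> Y) = a"
      using disj by (auto simp: Int_Un_distrib2)
    show "\<forall>a'\<in>{A. A \<subseteq> {1..m + n} \<and> card A = k \<and> card (A \<inter> {1..m}) = h}.
       (case (a' \<inter> {1..m}, a' \<inter> {m+1..m+n}) of (X, Y) \<Rightarrow> X \<union> Y) = a'"
      using un by auto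
    show "(\<lambda>(X, Y). X \<union> Y) ` (?X \<times> ?Y) \<subseteq> {A. A \<subseteq> {1..m + n} \<and> card A = k \<and> card (A \<inter> {1..m}) = h}"
    proof (rule image_subsetI)
      fix XY assume "XY \<in> ?X \<times> ?Y"
      then obtain X Y where XY: "XY = (X, Y)" and X: "X \<subseteq> {1..m}" "h = card X"
        and Y: "Y \<subseteq> {m+1..m+n}" "card Y = k - card X" by auto
      have fin: "finite X" "finite Y" using X Y by (auto intro: finite_subset)
      have "X \<inter> Y = {}" using X Y disj by blast
      hence "card (X \<union> Y) = k" using fin X Y assms by (simp add: card_Un_disjoint)
      moreover have "(X \<union> Y) \<inter> {1..m} = X" using X Y disj by blast
      moreover have "X \<union> Y \<subseteq> {1..m+n}" using X Y un by blast
      ultimately show "(case XY of (X, Y) \<Rightarrow> X \<union> Y) \<in> {A. A \<subseteq> {1..m + n} \<and> card A = k \<and> card (A \<inter> {1..m}) = h}"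
        by (simp add: XY X)
    qed
    show "(\<lambda>A. (A \<inter> {1..m}, A \<inter> {m+1..m+n})) ` {A. A \<subseteq> {1..m + n} \<and> card A = k \<and> card (A \<inter> {1..m}) = h} \<subseteq> ?X \<times> ?Y"
    proof (rule image_subsetI)
      fix A assume "A \<in> {A. A \<subseteq> {1..m + n} \<and> card A = k \<and> card (A \<inter> {1..m}) = h}"
      hence A: "A \<subseteq> {1..m+n}" "card A = k" "card (A \<inter> {1..m}) = h" by auto
      have "A = A \<inter> {1..m} \<union> A \<inter> {m+1..m+n}" using A un by blast
      hence "card A = card (A \<inter> {1..m} \<union> A \<inter> {m+1..m+n})" by simp
      also have "\<dots> = card (A \<inter> {1..m}) + card (A \<inter> {m+1..m+n})"
        using disj by (intro card_Un_disjoint) auto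
      finally have "card A = card (A \<inter> {1..m}) + card (A \<inter> {m+1..m+n})" .
      thus "(A \<inter> {1..m}, A \<inter> {m+1..m+n}) \<in> ?X \<times> ?Y" using A by simp
    qed
  qed
  hence "card {A. A \<subseteq> {1..m + n} \<and> card A = k \<and> card (A \<inter> {1..m}) = h} = card (?X \<times> ?Y)"
    by (rule bij_betw_same_card[symmetric])
  also have "\<dots> = (m choose h) * (n choose (k - h))"
    using n_subsets[of "{1..m}" h] n_subsets[of "{m+1..m+n}" "k - h"] by (simp add: card_cartesian_product)
  finally show ?thesis .
qed

lemma measure_low_ranked_first_sample_le:
  fixes P :: "real measure"
  assumes "prob_space P" "sets P = sets borel" "\<And>x. measure P {x} = 0" and k: "k \<le> m + n"
  shows "measure (PiM {1..m + n} (\<lambda>_. P))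
           {z \<in> space (PiM {1..m + n} (\<lambda>_. P)). real (card (low_ranked (m + n) k z \<inter> {1..m})) \<le> x}
       = (\<Sum>h | h \<le> k \<and> real h \<le> x. real ((m choose h) * (n choose (k - h)))) / ((m + n) choose k)"
proof -
  let ?H = "{h. h \<le> k \<and> real h \<le> x}"
  let ?F = "\<lambda>h. {A. A \<subseteq> {1..m + n} \<and> card A = k \<and> card (A \<inter> {1..m}) = h}"
  have "{A. A \<subseteq> {1..m + n} \<and> card A = k \<and> real (card (A \<inter> {1..m})) \<le> x} = (\<Union>h\<in>?H. ?F h)"
  proof -
    have "card (A \<inter> {1..m}) \<le> card A" if "A \<subseteq> {1..m + n}" for A
      using finite_subset[OF that] by (intro card_mono) auto
    thus ?thesis by auto
  qed
  moreover have "card (\<Union>h\<in>?H. ?F h) = (\<Sum>h\<in>?H. card (?F h))"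
  proof (rule card_UN_disjoint)
    show "finite ?H" by (rule finite_subset[of _ "{..k}"]) auto
    show "\<forall>h\<in>?H. finite (?F h)"
    proof
      show "finite (?F h)" for h by (rule finite_subset[of _ "Pow {1..m + n}"]) auto
    qed
  qed auto
  moreover have "\<dots> = (\<Sum>h\<in>?H. (m choose h) * (n choose (k - h)))"
    by (intro sum.cong refl card_subsets_split) auto
  ultimately have "card {A. A \<subseteq> {1..m + n} \<and> card A = k \<and> real (card (A \<inter> {1..m})) \<le> x}
      = (\<Sum>h\<in>?H. (m choose h) * (n choose (k - h)))" by simp
  with measure_low_ranked_event[OF assms, of "\<lambda>A. real (card (A \<inter> {1..m})) \<le> x"]
  show ?thesis by simp
qed

text \<open>
  The midranks are \<open>(r - 1/2) / N\<close>. With \<open>k\<close> of them below \<open>p\<close>, an observation receives the lower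
  score exactly when its rank is at most \<open>k\<close>. The constant part of the score disappears because the coefficients sum to zero.
\<close>

lemma rank_stat_eq:
  fixes m n N :: nat and z :: "nat \<Rightarrow> real" and p :: real
  defines "N \<equiv> m + n"
  assumes mn: "0 < m" "0 < n" and p: "0 < p" "p < 1" and inj: "inj_on z {1..N}" and k: "k \<le> N"
    and cut: "\<And>r. r \<in> {1..N} \<Longrightarrow> r \<le> k \<longleftrightarrow> (real r - 0.5) / real N < p"
  shows "rank_stat m n p z
       = - ((m * (k / N) - real (card (low_ranked N k z \<inter> {1..m}))) / sqrt (m * n / N * (p * (1 - p))))"
proof -
  let ?L = "low_ranked N k z"
  define s where "s = sqrt (m * n / N)"
  define H where "H = card (?L \<inter> {1..m})"
  have N: "0 < N" using mn by (simp add: N_def)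
  have s: "0 < s" "s * s = m * n / N" using mn N by (auto simp: s_def)
  have q: "0 < p * (1 - p)" using p by simp
  have ell: "ell p ((real (pooled_rank N z i) - 0.5) / N)
      = sqrt (p / (1 - p)) - indicator ?L i / sqrt (p * (1 - p))" if "i \<in> {1..N}" for i
  proof -
    let ?r = "pooled_rank N z i"
    have r: "?r \<in> {1..N}" using pooled_rank_bounds[OF that, of z] by simp
    have b: "0 \<le> (real ?r - 0.5) / N" "(real ?r - 0.5) / N \<le> 1"
      using r N by (auto simp: field_simps)
    have low: "i \<in> ?L \<longleftrightarrow> (real ?r - 0.5) / N < p"
      using that cut[OF r] by (simp add: low_ranked_def)
    show ?thesis
    proof (cases "i \<in> ?L")
      case True
      have "sqrt ((1 - p) / p) = (1 - p) / sqrt (p * (1 - p))" "sqrt (p / (1 - p)) = p / sqrt (p * (1 - p))"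
      proof -
        have "sqrt (a / b) = a / sqrt (a * b)" if "0 < a" "0 < b" for a b :: real
          using that real_div_sqrt[of a] unfolding real_sqrt_divide real_sqrt_mult
          by (metis divide_divide_eq_left less_imp_le)
        from this[of "1 - p" p] this[of p "1 - p"] p
        show "sqrt ((1 - p) / p) = (1 - p) / sqrt (p * (1 - p))" "sqrt (p / (1 - p)) = p / sqrt (p * (1 - p))"
          by (simp_all add: mult.commute)
      qed
      thus ?thesis using True low b p by (simp add: ell_def field_simps)
    next
      case False
      thus ?thesis using low b by (simp add: ell_def)
    qed
  qed
  have fin: "finite ?L" using low_ranked_subset by (rule finite_subset) simp
  have split: "(\<Sum>i=1..N. f i) = (\<Sum>i\<in>{1..m}. f i) + (\<Sum>i\<in>{m+1..N}. f i)" for f :: "nat \<Rightarrow> real"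
    by (subst sum.union_disjoint[symmetric]) (auto simp: N_def intro!: sum.cong)
  have c1: "coeff_c m n i = - s / m" if "i \<in> {1..m}" for i
    using that by (simp add: coeff_c_def s_def N_def divide_inverse)
  have c2: "coeff_c m n i = s / n" if "i \<in> {m+1..N}" for i
    using that by (simp add: coeff_c_def s_def N_def divide_inverse)
  have sumc: "(\<Sum>i=1..N. coeff_c m n i) = 0"
  proof -
    have "(\<Sum>i=1..N. coeff_c m n i) = (\<Sum>i\<in>{1..m}. - s / m) + (\<Sum>i\<in>{m+1..N}. s / n)"
      unfolding split by (intro arg_cong2[where f = "(+)"] sum.cong refl c1 c2)
    also have "\<dots> = 0" using mn by (simp add: N_def)
    finally show ?thesis .
  qed
  have H2: "card (?L \<inter> {m+1..N}) = k - H" "H \<le> k"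
  proof -
    have "k = card ?L" using card_low_ranked[OF inj k] by simp
    also have "?L = (?L \<inter> {1..m}) \<union> (?L \<inter> {m+1..N})"
      using low_ranked_subset[of N k z] by (force simp: N_def)
    also have "card \<dots> = H + card (?L \<inter> {m+1..N})"
      unfolding H_def using fin by (intro card_Un_disjoint) auto
    finally show "card (?L \<inter> {m+1..N}) = k - H" "H \<le> k" by auto
  qed
  have sumL: "(\<Sum>i=1..N. coeff_c m n i * indicator ?L i) = - s / m * H + s / n * (real k - real H)"
  proof -
    have "(\<Sum>i\<in>{1..m}. coeff_c m n i * indicator ?L i) = - s / m * H"
    proof -
      have "(\<Sum>i\<in>{1..m}. coeff_c m n i * indicator ?L i) = (\<Sum>i\<in>{1..m}. - s / m * indicator ?L i)"
        by (intro sum.cong) (auto simp: c1)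
      also have "\<dots> = - s / m * (\<Sum>i\<in>{1..m}. indicator ?L i)" by (rule sum_distrib_left[symmetric])
      also have "(\<Sum>i\<in>{1..m}. indicator ?L i) = real H"
        by (simp add: sum.If_cases indicator_def H_def Int_commute)
      finally show ?thesis .
    qed
    moreover have "(\<Sum>i\<in>{m+1..N}. coeff_c m n i * indicator ?L i) = s / n * (real k - real H)"
    proof -
      have "(\<Sum>i\<in>{m+1..N}. coeff_c m n i * indicator ?L i) = (\<Sum>i\<in>{m+1..N}. s / n * indicator ?L i)"
        by (intro sum.cong) (auto simp: c2)
      also have "\<dots> = s / n * (\<Sum>i\<in>{m+1..N}. indicator ?L i)" by (rule sum_distrib_left[symmetric])
      also have "(\<Sum>i\<in>{m+1..N}. indicator ?L i) = real (card (?L \<inter> {m+1..N}))"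
        by (simp add: sum.If_cases indicator_def Int_commute)
      finally show ?thesis using H2 by (simp add: of_nat_diff)
    qed
    ultimately show ?thesis unfolding split by simp
  qed
  have "rank_stat m n p z = (\<Sum>i=1..N. coeff_c m n i * (sqrt (p / (1 - p)) - indicator ?L i / sqrt (p * (1 - p))))"
    unfolding rank_stat_def N_def[symmetric] by (intro sum.cong refl arg_cong2[where f = "(*)"] ell)
  also have "\<dots> = (\<Sum>i=1..N. coeff_c m n i) * sqrt (p / (1 - p))
      - (\<Sum>i=1..N. coeff_c m n i * indicator ?L i) / sqrt (p * (1 - p))"
    unfolding sum_distrib_right sum_divide_distrib sum_subtractf[symmetric]
    by (intro sum.cong) (simp_all add: right_diff_distrib)
  also have "\<dots> = - (s / n * (real k - real H) - s / m * H) / sqrt (p * (1 - p))"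
    unfolding sumc sumL by (simp add: diff_divide_distrib add_divide_distrib)
  also have "s / n * (real k - real H) - s / m * H = (m * (k / N) - H) / s"
  proof -
    have "(s / n * (real k - real H) - s / m * H) * s = (s * s) * ((real k - real H) / n - H / m)"
      by (simp add: field_simps)
    also have "(real k - real H) / n - H / m = (m * real k - H * real N) / (real m * real n)"
      using mn by (simp add: N_def field_simps)
    also have "s * s * ((m * real k - H * real N) / (real m * real n)) = m * (k / N) - H"
      unfolding s(2) using mn N by (simp add: diff_divide_distrib right_diff_distrib)
    finally show ?thesis using s(1) by (simp add: field_simps)
  qed
  finally have "rank_stat m n p z = - ((m * (k / N) - H) / s) / sqrt (p * (1 - p))" .
  moreover have "sqrt (m * n / N * (p * (1 - p))) = s * sqrt (p * (1 - p))"
    unfolding s_def by (rule real_sqrt_mult)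
  ultimately show ?thesis by (simp add: H_def)
qed

text \<open>
  Replacing \<open>p\<close> by the nearby multiple \<open>k / N\<close> changes \<open>p (1 - p)\<close> by at most \<open>1 / (2 N)\<close>.
\<close>

lemma midrank_cutoff:
  fixes p :: real
  assumes N: "0 < N" and p: "0 < p" "p < 1"
  shows "\<exists>k::nat. \<bar>k / N - p\<bar> \<le> 1 / (2 * real N) \<and> k \<le> N \<and>
    (\<forall>r. r \<le> k \<longleftrightarrow> (real r - 0.5) / real N < p)"
proof -
  define k where "k = nat (\<lceil>N * p + 1/2\<rceil> - 1)"
  have "0 < N * p" using N p by simp
  hence c: "1 \<le> \<lceil>N * p + 1/2\<rceil>" by linarith
  hence k: "real k = of_int \<lceil>N * p + 1/2\<rceil> - 1" by (simp add: k_def)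
  have kb: "N * p - 1/2 \<le> real k" "real k < N * p + 1/2" unfolding k by linarith+
  have 1: "\<bar>k / N - p\<bar> \<le> 1 / (2 * real N)"
  proof -
    have "k / N - p = (real k - N * p) / N" using N by (simp add: field_simps)
    hence "\<bar>k / N - p\<bar> = \<bar>real k - N * p\<bar> / N" by (simp add: abs_divide)
    moreover have "\<bar>real k - N * p\<bar> \<le> 1 / 2" using kb by linarith
    ultimately show ?thesis using N by (simp add: field_simps)
  qed
  have "N * p < N" using N p by simp
  hence "real k < real N + 1" using kb by linarith
  hence 2: "k \<le> N" by linarith
  have 3: "r \<le> k \<longleftrightarrow> (real r - 0.5) / real N < p" for r
  proof -
    have "int k = \<lceil>N * p + 1/2\<rceil> - 1" using c by (simp add: k_def)
    hence "r \<le> k \<longleftrightarrow> int r < \<lceil>N * p + 1/2\<rceil>" by linarith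
    also have "\<dots> \<longleftrightarrow> real r < N * p + 1/2" by (simp add: less_ceiling_iff)
    also have "\<dots> \<longleftrightarrow> (real r - 0.5) / real N < p" using N by (simp add: field_simps)
    finally show ?thesis .
  qed
  show ?thesis using 1 2 3 by blast
qed

lemma measure_rank_stat_tail:
  fixes P :: "real measure" and p w :: real
  assumes P: "prob_space P" "sets P = sets borel" "\<And>x. measure P {x} = 0"
    and mn: "0 < m" "0 < n" and p: "0 < p" "p < 1" and k: "k \<le> m + n"
    and cut: "\<And>r. r \<in> {1..m + n} \<Longrightarrow> r \<le> k \<longleftrightarrow> (real r - 0.5) / real (m + n) < p"
  shows "measure (PiM {1..m + n} (\<lambda>_. P))
           {z \<in> space (PiM {1..m + n} (\<lambda>_. P)). w * sqrt (real (m + n)) \<le> - rank_stat m n p z}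
       = (\<Sum>h | h \<le> k \<and> real h \<le> m * (real k / real (m + n)) - w * sqrt (m * n * (p * (1 - p))).
            real ((m choose h) * (n choose (k - h)))) / ((m + n) choose k)"
proof -
  define N where "N = m + n"
  let ?M = "PiM {1..m + n} (\<lambda>_. P)"
  let ?x = "m * (real k / real (m + n)) - w * sqrt (m * n * (p * (1 - p)))"
  interpret prob_space ?M by (rule prob_space_PiM) (rule P(1))
  have N: "0 < N" using mn by (simp add: N_def)
  have pos: "0 < sqrt (m * n / N * (p * (1 - p)))" using mn p N by simp
  have sq: "sqrt N * sqrt (m * n / N * (p * (1 - p))) = sqrt (m * n * (p * (1 - p)))"
    using N by (simp flip: real_sqrt_mult)
  have "prob {z \<in> space ?M. w * sqrt (real (m + n)) \<le> - rank_stat m n p z}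
      = prob {z \<in> space ?M. real (card (low_ranked (m + n) k z \<inter> {1..m})) \<le> ?x}"
  proof (rule finite_measure_eq_AE)
    note [measurable] = borel_measurable_rank_stat[OF P(2)]
    show "{z \<in> space ?M. w * sqrt (real (m + n)) \<le> - rank_stat m n p z} \<in> events" by measurable
    show "{z \<in> space ?M. real (card (low_ranked (m + n) k z \<inter> {1..m})) \<le> ?x} \<in> events"
      by (rule low_ranked_event_measurable[OF P(2)])
    show "AE z in ?M. (z \<in> {z \<in> space ?M. w * sqrt (real (m + n)) \<le> - rank_stat m n p z})
       = (z \<in> {z \<in> space ?M. real (card (low_ranked (m + n) k z \<inter> {1..m})) \<le> ?x})"
      using AE_PiM_inj_on[OF P finite_atLeastAtMost[of 1 "m + n"]]
    proof eventually_elim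
      case (elim z)
      let ?d = "m * (k / N) - real (card (low_ranked N k z \<inter> {1..m}))"
      have "rank_stat m n p z = - (?d / sqrt (m * n / N * (p * (1 - p))))"
        unfolding N_def by (rule rank_stat_eq[OF mn p elim k cut])
      hence "w * sqrt N \<le> - rank_stat m n p z \<longleftrightarrow> w * (sqrt N * sqrt (m * n / N * (p * (1 - p)))) \<le> ?d"
        using pos by (simp add: pos_le_divide_eq mult.assoc)
      thus ?case unfolding sq by (auto simp: N_def)
    qed
  qed
  thus ?thesis using measure_low_ranked_first_sample_le[OF P k, of ?x] by simp
qed

section \<open>Moderate deviations of the rank statistics\<close>

text \<open>
  The uniform moderate deviation bound for one cut point. With \<open>a = p (1 - p) \<ge> 1 / (4 d)\<close> and
  \<open>v = \<theta> (1 - \<theta>)\<close>, hypothesis \<open>h1\<close> makes \<open>v / a\<close> close to \<open>1\<close>; \<open>h1\<close> and \<open>h2\<close> together make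
  \<open>D + 1\<close> small compared with \<open>m v\<close> and \<open>n v\<close>, so that the exponential tilts are small; and
  \<open>h3\<close> and \<open>h4\<close> make \<open>D\<close> large, so that rounding \<open>D\<close> up to \<open>D + 1\<close> is harmless.
\<close>

lemma rank_stat_tail_bounds:
  fixes P :: "real measure" and m n N :: nat and p w \<epsilon> c d K q :: real
  defines "N \<equiv> m + n" and "K \<equiv> \<epsilon> * (1 - \<epsilon>) * c / 2"
    and "q \<equiv> measure (PiM {1..m + n} (\<lambda>_. P))
           {z \<in> space (PiM {1..m + n} (\<lambda>_. P)). w * sqrt (real (m + n)) \<le> - rank_stat m n p z}"
  assumes P: "prob_space P" "sets P = sets borel" "\<And>x. measure P {x} = 0"
    and eps: "0 < \<epsilon>" "\<epsilon> < 1" and c: "0 < c" and mn: "0 < m" "0 < n" "c * N \<le> m" "c * N \<le> n"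
    and d: "1 \<le> d" and p: "1 / (d + 1) \<le> p" "p \<le> 1 - 1 / (d + 1)" and w: "0 < w"
    and h1: "4 * d \<le> K * N" and h2: "w\<^sup>2 * (4 * d) \<le> K\<^sup>2" and h3: "4 * d \<le> c\<^sup>2 * \<epsilon>\<^sup>2 * N"
    and h4: "1 \<le> N * w\<^sup>2"
  shows "q \<le> (real N + 1) * exp (- ((1 - \<epsilon>) / (1 + \<epsilon>) * (N * w\<^sup>2) / 2))"
    and "exp (- ((1 + \<epsilon>) ^ 3 / (1 - \<epsilon>) * (N * w\<^sup>2) / 2)) / (real N + 1)\<^sup>2 \<le> q"
proof -
  define a where "a = p * (1 - p)"
  have N: "0 < N" using mn by (simp add: N_def)
  have "0 < 1 / (d + 1)" using d by simp
  hence p01: "0 < p" "p < 1" using p by linarith+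
  have a: "1 / (4 * d) \<le> a"
  proof -
    have "0 \<le> (p - 1 / (d + 1)) * (1 - 1 / (d + 1) - p)" using p by simp
    hence "1 / (d + 1) * (1 - 1 / (d + 1)) \<le> a" by (simp add: a_def algebra_simps)
    moreover have "1 / (2 * d) * (1 / 2) \<le> 1 / (d + 1) * (1 - 1 / (d + 1))"
      using d by (intro mult_mono frac_le) (auto simp: field_simps)
    ultimately show ?thesis by simp
  qed
  hence da: "1 \<le> a * (4 * d)" using d by (simp add: field_simps)
  have a0: "0 < a" using p01 by (simp add: a_def)
  have K: "0 < K" using eps c by (simp add: K_def)
  have Ke: "2 * K \<le> \<epsilon>"
  proof -
    have "c * N + c * N \<le> real m + real n" using mn by linarith
    also have "\<dots> = N" by (simp add: N_def)
    finally have "(2 * c) * N \<le> 1 * N" by simp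
    hence "2 * c \<le> 1" using N by (intro mult_right_le_imp_le[of "2 * c" "real N" 1]) auto
    hence "(1 - \<epsilon>) * c \<le> 1 * 1" using eps c by (intro mult_mono) auto
    hence "\<epsilon> * ((1 - \<epsilon>) * c) \<le> \<epsilon> * 1" using eps by (intro mult_left_mono) auto
    thus ?thesis by (simp add: K_def mult.assoc)
  qed
  \<comment> \<open>As \<open>1 \<le> a * (4 * d)\<close>, the hypotheses \<open>h1\<close> and \<open>h2\<close> can be restated with \<open>a\<close> in place of \<open>d\<close>.\<close>
  have KNa: "1 \<le> K * N * a"
  proof -
    have "1 \<le> a * (4 * d)" by (rule da)
    also have "\<dots> \<le> a * (K * N)" using h1 a0 by (intro mult_left_mono) auto
    finally show ?thesis by (simp add: mult_ac)
  qed
  have wK: "w \<le> K * sqrt a"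
  proof -
    have "w\<^sup>2 \<le> w\<^sup>2 * (a * (4 * d))" using mult_left_mono[OF da, of "w\<^sup>2"] by simp
    also have "\<dots> = a * (w\<^sup>2 * (4 * d))" by (simp only: mult_ac)
    also have "\<dots> \<le> a * K\<^sup>2" using h2 a0 by (intro mult_left_mono) auto
    also have "\<dots> = (K * sqrt a)\<^sup>2" using a0 by (simp add: power_mult_distrib)
    finally show ?thesis by (rule power2_le_imp_le) (use K a0 in simp)
  qed
  obtain k where k: "\<bar>k / N - p\<bar> \<le> 1 / (2 * real N)" "k \<le> N"
    and cut: "\<And>r. r \<le> k \<longleftrightarrow> (real r - 0.5) / real N < p"
    using midrank_cutoff[OF N p01] by blast
  define \<theta> where "\<theta> = real k / real (m + n)"
  define v where "v = \<theta> * (1 - \<theta>)"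
  have va: "\<bar>v - a\<bar> \<le> \<epsilon> * a"
  proof -
    have "v - a = (\<theta> - p) * (1 - \<theta> - p)" by (simp add: v_def a_def algebra_simps)
    moreover have "0 \<le> \<theta>" "\<theta> \<le> 1" using k(2) N by (auto simp: \<theta>_def N_def)
    hence "\<bar>1 - \<theta> - p\<bar> \<le> 1" using p01 by linarith
    hence "\<bar>\<theta> - p\<bar> * \<bar>1 - \<theta> - p\<bar> \<le> \<bar>\<theta> - p\<bar> * 1" by (intro mult_left_mono) auto
    ultimately have "\<bar>v - a\<bar> \<le> \<bar>\<theta> - p\<bar> * 1"
      by (simp add: abs_mult)
    also have "\<dots> \<le> 1 / (2 * real N)" using k(1) by (simp add: \<theta>_def N_def)
    also have "\<dots> \<le> K * a" using KNa N by (simp add: field_simps)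
    also have "\<dots> \<le> \<epsilon> * a" using Ke K a0 by (intro mult_right_mono) auto
    finally show ?thesis .
  qed
  have v1: "(1 - \<epsilon>) * a \<le> v" "v \<le> (1 + \<epsilon>) * a" using va by (auto simp: abs_le_iff algebra_simps)
  have v: "0 < v"
  proof -
    have "0 < (1 - \<epsilon>) * a" using eps a0 by simp
    thus ?thesis using v1 by linarith
  qed
  have k0: "0 < k" "k < m + n"
  proof -
    have "\<theta> \<noteq> 0" "\<theta> \<noteq> 1" using v by (auto simp: v_def)
    thus "0 < k" "k < m + n" using k(2) N by (auto simp: \<theta>_def N_def order.order_iff_strict)
  qed
  define D where "D = w * sqrt (real m * real n * (p * (1 - p)))"
  have D2: "D\<^sup>2 = w\<^sup>2 * (real m * real n * a)" using a0 by (simp add: D_def power_mult_distrib a_def)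
  have D0: "0 < D" using w mn p01 by (simp add: D_def)
  have Dsum: "D\<^sup>2 * (1 / m + 1 / n) = N * w\<^sup>2 * a"
    unfolding D2 using mn by (simp add: N_def field_simps)
  have Dle: "D + 1 \<le> \<epsilon> * (x * v)" if x: "c * N \<le> x" for x :: real
  proof -
    have "D \<le> K * N * a"
    proof -
      have "sqrt (real m * real n * a) \<le> sqrt ((real N)\<^sup>2 * a)"
      proof -
        have "real m * real n \<le> (real N)\<^sup>2"
          unfolding power2_eq_square by (rule mult_mono) (auto simp: N_def)
        thus ?thesis using a0 by (intro real_sqrt_le_mono mult_right_mono) auto
      qed
      hence "D \<le> w * (N * sqrt a)"
        using w by (simp add: D_def a_def real_sqrt_mult)
      also have "\<dots> \<le> (K * sqrt a) * (N * sqrt a)"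
        using wK a0 by (intro mult_right_mono) auto
      also have "\<dots> = K * N * a" using a0 by (simp add: mult_ac)
      finally show ?thesis .
    qed
    hence "D + 1 \<le> 2 * (K * N * a)" using KNa by linarith
    also have "\<dots> = \<epsilon> * ((c * N) * ((1 - \<epsilon>) * a))" by (simp add: K_def)
    also have "\<dots> \<le> \<epsilon> * (x * v)"
    proof -
      have "0 \<le> c * N" using c by simp
      hence "0 \<le> x" using x by linarith
      hence "(c * N) * ((1 - \<epsilon>) * a) \<le> x * v" using x v1 eps a0 by (intro mult_mono) auto
      thus ?thesis using eps by (intro mult_left_mono) auto
    qed
    finally show ?thesis .
  qed
  have epsD: "1 \<le> \<epsilon> * D"
  proof -
    have "1 * 1 \<le> (N * w\<^sup>2) * (a * (4 * d))" using h4 da by (intro mult_mono) auto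
    also have "\<dots> \<le> (N * w\<^sup>2) * (a * (c\<^sup>2 * \<epsilon>\<^sup>2 * N))"
      using h3 a0 by (intro mult_left_mono) auto
    also have "\<dots> = \<epsilon>\<^sup>2 * (w\<^sup>2 * (((c * N) * (c * N)) * a))" by (simp add: power2_eq_square mult_ac)
    also have "\<dots> \<le> \<epsilon>\<^sup>2 * (w\<^sup>2 * ((real m * real n) * a))"
    proof -
      have "(c * N) * (c * N) \<le> real m * real n" using mn c by (intro mult_mono) auto
      thus ?thesis using a0 by (intro mult_left_mono mult_right_mono) auto
    qed
    also have "\<dots> = (\<epsilon> * D)\<^sup>2" by (simp add: D2 power_mult_distrib)
    finally have "1\<^sup>2 \<le> (\<epsilon> * D)\<^sup>2" by simp
    thus ?thesis by (rule power2_le_imp_le) (use D0 eps in simp)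
  qed
  have q: "q = (\<Sum>h | h \<le> k \<and> real h \<le> m * \<theta> - D. real ((m choose h) * (n choose (k - h)))) / ((m + n) choose k)"
    unfolding q_def \<theta>_def D_def
    by (rule measure_rank_stat_tail[OF P mn(1,2) p01]) (use k(2) cut in \<open>auto simp: N_def\<close>)
  have Nw: "0 \<le> N * w\<^sup>2" by simp
  have "q \<le> (real (m + n) + 1) * exp (- ((1 - \<epsilon>) * (D\<^sup>2 * (1 / m + 1 / n)) / (2 * v)))"
    unfolding q \<theta>_def v_def
    by (rule hypergeometric_tail_le_gaussian)
      (use k0 mn D0 eps Dle[of m] Dle[of n] in \<open>auto simp: v_def \<theta>_def\<close>)
  also have "\<dots> \<le> (real N + 1) * exp (- ((1 - \<epsilon>) / (1 + \<epsilon>) * (N * w\<^sup>2) / 2))"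
  proof -
    have "(1 - \<epsilon>) / (1 + \<epsilon>) * (N * w\<^sup>2) / 2 = ((1 - \<epsilon>) * (N * w\<^sup>2) / 2) * (1 / (1 + \<epsilon>))" by simp
    also have "\<dots> \<le> ((1 - \<epsilon>) * (N * w\<^sup>2) / 2) * (a / v)"
    proof (rule mult_left_mono)
      show "1 / (1 + \<epsilon>) \<le> a / v" using eps v v1 by (simp add: field_simps)
      show "0 \<le> (1 - \<epsilon>) * (N * w\<^sup>2) / 2" using eps Nw by (intro divide_nonneg_nonneg mult_nonneg_nonneg) auto
    qed
    also have "\<dots> = (1 - \<epsilon>) * (N * w\<^sup>2 * a) / (2 * v)" by simp
    finally show ?thesis unfolding Dsum N_def by simp
  qed
  finally show "q \<le> (real N + 1) * exp (- ((1 - \<epsilon>) / (1 + \<epsilon>) * (N * w\<^sup>2) / 2))" .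
  have "exp (- ((1 + \<epsilon>) ^ 3 / (1 - \<epsilon>) * (N * w\<^sup>2) / 2)) / (real N + 1)\<^sup>2
     \<le> exp (- ((1 + \<epsilon>) * ((D + 1)\<^sup>2 * (1 / m + 1 / n)) / (2 * v))) / (real (m + n) + 1)\<^sup>2"
  proof -
    have "(D + 1)\<^sup>2 \<le> ((1 + \<epsilon>) * D)\<^sup>2"
      using D0 epsD by (intro power_mono) (auto simp: algebra_simps)
    hence "(D + 1)\<^sup>2 * (1 / m + 1 / n) \<le> ((1 + \<epsilon>) * D)\<^sup>2 * (1 / m + 1 / n)"
      by (intro mult_right_mono) auto
    also have "\<dots> = (1 + \<epsilon>)\<^sup>2 * (N * w\<^sup>2 * a)"
      unfolding Dsum[symmetric] by (simp add: power_mult_distrib)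
    finally have "(1 + \<epsilon>) * ((D + 1)\<^sup>2 * (1 / m + 1 / n)) / (2 * v)
        \<le> (1 + \<epsilon>) * ((1 + \<epsilon>)\<^sup>2 * (N * w\<^sup>2 * a)) / (2 * v)"
      using eps v by (intro divide_right_mono mult_left_mono) auto
    also have "\<dots> = ((1 + \<epsilon>) ^ 3 * (N * w\<^sup>2) / 2) * (a / v)"
      by (simp add: power3_eq_cube power2_eq_square mult_ac)
    also have "\<dots> \<le> ((1 + \<epsilon>) ^ 3 * (N * w\<^sup>2) / 2) * (1 / (1 - \<epsilon>))"
    proof (rule mult_left_mono)
      show "a / v \<le> 1 / (1 - \<epsilon>)" using eps v v1 by (simp add: field_simps)
      show "0 \<le> (1 + \<epsilon>) ^ 3 * (N * w\<^sup>2) / 2" using eps Nw by (intro divide_nonneg_nonneg mult_nonneg_nonneg) auto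
    qed
    also have "\<dots> = (1 + \<epsilon>) ^ 3 / (1 - \<epsilon>) * (N * w\<^sup>2) / 2" by simp
    finally have "exp (- ((1 + \<epsilon>) ^ 3 / (1 - \<epsilon>) * (N * w\<^sup>2) / 2))
        \<le> exp (- ((1 + \<epsilon>) * ((D + 1)\<^sup>2 * (1 / m + 1 / n)) / (2 * v)))"
      by (simp only: exp_le_cancel_iff neg_le_iff_le)
    thus ?thesis unfolding N_def by (intro divide_right_mono) auto
  qed
  also have "\<dots> \<le> q"
    unfolding q \<theta>_def v_def
    by (rule hypergeometric_tail_ge_gaussian)
      (use k0 mn D0 eps Dle[of m] Dle[of n] in \<open>auto simp: v_def \<theta>_def\<close>)
  finally show "exp (- ((1 + \<epsilon>) ^ 3 / (1 - \<epsilon>) * (N * w\<^sup>2) / 2)) / (real N + 1)\<^sup>2 \<le> q" .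
qed

text \<open>
  A squeeze whose bounds depend on a parameter \<open>\<epsilon>\<close> but not on \<open>N\<close>, which avoids choosing
  \<open>\<epsilon>\<close> as a function of \<open>N\<close>.
\<close>

lemma tendsto_squeeze_at_right_0:
  fixes X :: "nat \<Rightarrow> real" and f g :: "real \<Rightarrow> real"
  assumes f: "(f \<longlongrightarrow> l) (at_right 0)" and g: "(g \<longlongrightarrow> l) (at_right 0)"
    and X: "\<And>\<epsilon>. 0 < \<epsilon> \<Longrightarrow> \<epsilon> < 1 \<Longrightarrow> \<forall>\<^sub>F N in sequentially. f \<epsilon> \<le> X N \<and> X N \<le> g \<epsilon>"
  shows "X \<longlonglongrightarrow> l"
proof (rule order_tendstoI)
  have small: "\<forall>\<^sub>F \<epsilon> in at_right 0. 0 < \<epsilon> \<and> \<epsilon> < (1::real)"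
    using eventually_at_right_real[of 0 1] by (auto elim: eventually_mono)
  fix b
  {
    assume "b < l"
    hence "\<forall>\<^sub>F \<epsilon> in at_right 0. (b < f \<epsilon>) \<and> 0 < \<epsilon> \<and> \<epsilon> < 1"
      using order_tendstoD(1)[OF f] small by (auto intro: eventually_conj)
    then obtain \<epsilon> where "b < f \<epsilon>" "0 < \<epsilon>" "\<epsilon> < 1"
      using eventually_happens'[OF trivial_limit_at_right_real] by blast
    with X[of \<epsilon>] show "\<forall>\<^sub>F N in sequentially. b < X N"
      by (auto elim!: eventually_mono)
  next
    assume "l < b"
    hence "\<forall>\<^sub>F \<epsilon> in at_right 0. (g \<epsilon> < b) \<and> 0 < \<epsilon> \<and> \<epsilon> < 1"
      using order_tendstoD(2)[OF g] small by (auto intro: eventually_conj)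
    then obtain \<epsilon> where "g \<epsilon> < b" "0 < \<epsilon>" "\<epsilon> < 1"
      using eventually_happens'[OF trivial_limit_at_right_real] by blast
    with X[of \<epsilon>] show "\<forall>\<^sub>F N in sequentially. X N < b"
      by (auto elim!: eventually_mono)
  }
qed

text \<open>
  Union bound from above; from below, the maximum is at least its first entry.
\<close>

lemma max_stat_tail_bounds:
  fixes P :: "real measure" and m n d :: nat and p :: "nat \<Rightarrow> real" and c L U :: real
  defines "M \<equiv> PiM {1..m + n} (\<lambda>_. P)"
  assumes P: "prob_space P" "sets P = sets borel" and d: "1 \<le> d"
    and U: "\<And>j. j \<in> {1..d} \<Longrightarrow> measure M {z \<in> space M. c \<le> - rank_stat m n (p j) z} \<le> U"
    and L: "L \<le> measure M {z \<in> space M. c \<le> - rank_stat m n (p 1) z}"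
  shows "measure M {z \<in> space M. c \<le> max_stat m n d p z} \<le> real d * U"
    and "L \<le> measure M {z \<in> space M. c \<le> max_stat m n d p z}"
proof -
  interpret prob_space M unfolding M_def by (rule prob_space_PiM) (rule P(1))
  let ?A = "\<lambda>j. {z \<in> space M. c \<le> - rank_stat m n (p j) z}"
  have A: "?A j \<in> events" for j
  proof -
    have [measurable]: "rank_stat m n (p j) \<in> borel_measurable M"
      unfolding M_def by (rule borel_measurable_rank_stat[OF P(2)])
    show ?thesis by measurable
  qed
  have "c \<le> max_stat m n d p z \<longleftrightarrow> (\<exists>j\<in>{1..d}. c \<le> - rank_stat m n (p j) z)" for z
    unfolding max_stat_def using d by (subst Max_ge_iff) auto
  hence eq: "{z \<in> space M. c \<le> max_stat m n d p z} = (\<Union>j\<in>{1..d}. ?A j)" by auto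
  have "prob (\<Union>j\<in>{1..d}. ?A j) \<le> (\<Sum>j\<in>{1..d}. prob (?A j))"
    using A by (intro finite_measure_subadditive_finite) auto
  also have "\<dots> \<le> (\<Sum>j\<in>{1..d}. U)" by (intro sum_mono U)
  finally show "prob {z \<in> space M. c \<le> max_stat m n d p z} \<le> real d * U" unfolding eq by simp
  have "prob (?A 1) \<le> prob (\<Union>j\<in>{1..d}. ?A j)"
    using A d by (intro finite_measure_mono sets.finite_UN) auto
  thus "L \<le> prob {z \<in> space M. c \<le> max_stat m n d p z}" unfolding eq using L by linarith
qed

theorem theorem3:
  fixes m n \<Delta> :: "nat \<Rightarrow> nat"
    and \<eta> \<upsilon> :: real
    and F1 G1 :: "real \<Rightarrow> real"
    and P0 :: "real measure"
    and \<pi> :: "nat \<Rightarrow> nat \<Rightarrow> real"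
    and w :: "nat \<Rightarrow> real"
  assumes "\<And>N. m N + n N = N"
    and "(\<lambda>N. real (m N) / real N) \<longlonglongrightarrow> \<eta>"
    and "0 < \<eta>" and "\<eta> < 1"
    and "distribution_function F1" and "continuous_on UNIV F1"
    and "distribution_function G1" and "continuous_on UNIV G1"
    and "\<exists>z. F1 z < G1 z"
    and "real_distribution P0"
    and "cdf P0 = (\<lambda>z. \<eta> * F1 z + (1 - \<eta>) * G1 z)"
    and "mono_on {2..} \<Delta>"
    and "\<And>N. N \<ge> 2 \<Longrightarrow> 1 < \<Delta> N \<and> \<Delta> N \<le> N"
    and "\<And>N j. N \<ge> 2 \<Longrightarrow> j \<in> {1..\<Delta> N} \<Longrightarrow> 0 < \<pi> j N \<and> \<pi> j N < 1"
    and "\<And>N. N \<ge> 2 \<Longrightarrow> strict_mono_on {1..\<Delta> N} (\<lambda>j. \<pi> j N)"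
    and "filterlim \<Delta> at_top sequentially"
    and "(\<lambda>N. real (\<Delta> N)) \<in> o(\<lambda>N. real N)"
    and "\<And>N. N \<ge> 2 \<Longrightarrow> \<pi> 1 N \<ge> 1 / (real (\<Delta> N) + 1)"
    and "\<And>N. N \<ge> 2 \<Longrightarrow> \<pi> (\<Delta> N) N \<le> 1 - 1 / (real (\<Delta> N) + 1)"
    and "\<And>N. N \<ge> 2 \<Longrightarrow> w N > 0"
    and "w \<longlonglongrightarrow> 0"
    and "filterlim (\<lambda>N. real N * (w N)\<^sup>2 / ln (real N)) at_top sequentially"
    and "0 < \<upsilon>" and "\<upsilon> < 1"
    and "(\<lambda>N. w N powr (1 - \<upsilon>) * real (\<Delta> N)) \<longlonglongrightarrow> 0"
  shows "(\<lambda>N. - (1 / (real N * (w N)\<^sup>2)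
            * ln (measure (PiM {1..N} (\<lambda>_. P0))
                   {z \<in> space (PiM {1..N} (\<lambda>_. P0)).
                      max_stat (m N) (n N) (\<Delta> N) (\<lambda>j. \<pi> j N) z \<ge> w N * sqrt (real N)})))
         \<longlonglongrightarrow> 1 / 2"
proof -
  note mn = assms(1) and eta = assms(2-4) and Delta = assms(13) and w_pos = assms(20)
    and ups = assms(23,24)
  interpret P0: real_distribution P0 by fact
  have ps: "prob_space P0" by unfold_locales
  have sets: "sets P0 = sets borel" by simp
  have atomless: "measure P0 {x} = 0" for x
  proof -
    have "continuous_on UNIV (cdf P0)"
      unfolding assms(11) using assms(6,8) by (intro continuous_intros)
    hence "isCont (cdf P0) x" by (simp add: continuous_on_eq_continuous_at)
    thus ?thesis by (simp add: P0.isCont_cdf)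
  qed
  \<comment> \<open>Both sample sizes are eventually at least \<open>c * N\<close>.\<close>
  define c where "c = min \<eta> (1 - \<eta>) / 2"
  have c: "0 < c" "c < \<eta>" "c < 1 - \<eta>" using eta by (auto simp: c_def min_def field_simps)
  have ev_m: "\<forall>\<^sub>F N in sequentially. c * N \<le> m N"
    using order_tendstoD(1)[OF eta(1) c(2)] eventually_gt_at_top[of 0]
    by eventually_elim (simp add: field_simps)
  have "\<eta> < 1 - c" using c by simp
  from order_tendstoD(2)[OF eta(1) this] eventually_gt_at_top[of 0]
  have ev_n: "\<forall>\<^sub>F N in sequentially. c * N \<le> n N"
  proof eventually_elim
    case (elim N)
    have "real (m N) + real (n N) = N" using mn[of N] by (simp flip: of_nat_add)
    thus ?case using elim by (simp add: field_simps)
  qed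
  have ev_Delta: "\<forall>\<^sub>F N in sequentially. 4 * real (\<Delta> N) \<le> C * N" if "0 < C" for C :: real
    using landau_o.smallD[OF assms(17), of "C / 4"] that by (auto simp: field_simps)
  have ev_w: "\<forall>\<^sub>F N in sequentially. (w N)\<^sup>2 * (4 * real (\<Delta> N)) \<le> C" if "0 < C" for C
  proof -
    have "0 < C / 4" using that by simp
    from order_tendstoD(2)[OF assms(25) this] order_tendstoD(2)[OF assms(21) zero_less_one]
      eventually_ge_at_top[of 2]
    show ?thesis
    proof eventually_elim
      case (elim N)
      have w: "0 < w N" using elim w_pos by simp
      \<comment> \<open>Since \<open>w < 1\<close> and \<open>1 - \<upsilon> < 2\<close>, the hypothesis on \<open>w\<close> implies \<open>w\<^sup>2 \<Delta> \<longlonglongrightarrow> 0\<close>.\<close>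
      have "(w N)\<^sup>2 = w N powr 2" using w by (simp add: powr_numeral)
      also have "\<dots> \<le> w N powr (1 - \<upsilon>)" using elim w ups by (intro powr_mono') auto
      finally have "(w N)\<^sup>2 * real (\<Delta> N) \<le> w N powr (1 - \<upsilon>) * real (\<Delta> N)"
        by (intro mult_right_mono) auto
      thus ?case using elim(1) by simp
    qed
  qed
  have ev_log: "\<forall>\<^sub>F N in sequentially. C * ln (real N) \<le> N * (w N)\<^sup>2" for C :: real
  proof -
    have "\<forall>\<^sub>F N in sequentially. C \<le> real N * (w N)\<^sup>2 / ln (real N)"
      using assms(22) by (auto simp: filterlim_at_top)
    thus ?thesis using eventually_ge_at_top[of 2]
      by eventually_elim (simp add: field_simps)
  qed
  define f g where "f \<epsilon> = (1 - \<epsilon>) / (1 + \<epsilon>) / 2 - \<epsilon>" and "g \<epsilon> = (1 + \<epsilon>) ^ 3 / (1 - \<epsilon>) / 2 + \<epsilon>" for \<epsilon> :: real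
  show ?thesis
  proof (rule tendsto_squeeze_at_right_0[of f _ g])
    show "(f \<longlongrightarrow> 1 / 2) (at_right 0)" "(g \<longlongrightarrow> 1 / 2) (at_right 0)"
      unfolding f_def g_def by (auto intro!: tendsto_eq_intros)
  next
    fix \<epsilon> :: real assume eps: "0 < \<epsilon>" "\<epsilon> < 1"
    have K: "0 < \<epsilon> * (1 - \<epsilon>) * c / 2" "0 < (\<epsilon> * (1 - \<epsilon>) * c / 2)\<^sup>2" "0 < c\<^sup>2 * \<epsilon>\<^sup>2" using eps c by auto
    show "\<forall>\<^sub>F N in sequentially. f \<epsilon> \<le> - (1 / (real N * (w N)\<^sup>2)
            * ln (measure (PiM {1..N} (\<lambda>_. P0))
                   {z \<in> space (PiM {1..N} (\<lambda>_. P0)).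
                      max_stat (m N) (n N) (\<Delta> N) (\<lambda>j. \<pi> j N) z \<ge> w N * sqrt (real N)}))
        \<and> - (1 / (real N * (w N)\<^sup>2)
            * ln (measure (PiM {1..N} (\<lambda>_. P0))
                   {z \<in> space (PiM {1..N} (\<lambda>_. P0)).
                      max_stat (m N) (n N) (\<Delta> N) (\<lambda>j. \<pi> j N) z \<ge> w N * sqrt (real N)})) \<le> g \<epsilon>"
      using ev_m ev_n ev_Delta[OF K(1)] ev_Delta[OF K(3)] ev_w[OF K(2)] ev_log[of 1] ev_log[of "4 / \<epsilon>"]
        eventually_ge_at_top[of 3]
    proof eventually_elim
      case (elim N)
      define B where "B = real N * (w N)\<^sup>2"
      define Q where "Q = measure (PiM {1..N} (\<lambda>_. P0))
                   {z \<in> space (PiM {1..N} (\<lambda>_. P0)).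
                      max_stat (m N) (n N) (\<Delta> N) (\<lambda>j. \<pi> j N) z \<ge> w N * sqrt (real N)}"
      have N: "3 \<le> N" "0 < N" "2 \<le> N" using elim by auto
      have mnN: "m N + n N = N" by (rule mn)
      have "0 < c * N" using c N by simp
      hence pos: "0 < m N" "0 < n N" using elim(1,2) by (auto intro!: Nat.gr0I)
      have d: "1 < \<Delta> N" "\<Delta> N \<le> N" using Delta[OF N(3)] by auto
      have range: "1 / (real (\<Delta> N) + 1) \<le> \<pi> j N \<and> \<pi> j N \<le> 1 - 1 / (real (\<Delta> N) + 1)"
        if j: "j \<in> {1..\<Delta> N}" for j
      proof -
        have "\<pi> 1 N \<le> \<pi> j N" "\<pi> j N \<le> \<pi> (\<Delta> N) N"
          using strict_mono_on_leD[OF assms(15)[OF N(3)], of 1 j]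
            strict_mono_on_leD[OF assms(15)[OF N(3)], of j "\<Delta> N"] j d by auto
        thus ?thesis using assms(18,19)[OF N(3)] by linarith
      qed
      have "exp 1 \<le> real N" using exp_le N by (meson le_trans numeral_le_real_of_nat_iff order_trans)
      hence "1 \<le> ln (real N)" using N by (simp add: ln_ge_iff)
      hence B: "1 \<le> B" using elim(6) by (simp add: B_def)
      define U where "U = (real N + 1) * exp (- ((1 - \<epsilon>) / (1 + \<epsilon>) * B / 2))"
      define L where "L = exp (- ((1 + \<epsilon>) ^ 3 / (1 - \<epsilon>) * B / 2)) / (real N + 1)\<^sup>2"
      let ?M = "PiM {1..m N + n N} (\<lambda>_. P0)"
      have tail: "measure ?M {z \<in> space ?M. w N * sqrt (real (m N + n N)) \<le> - rank_stat (m N) (n N) (\<pi> j N) z} \<le> U"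
          "L \<le> measure ?M {z \<in> space ?M. w N * sqrt (real (m N + n N)) \<le> - rank_stat (m N) (n N) (\<pi> j N) z}"
        if j: "j \<in> {1..\<Delta> N}" for j
        using rank_stat_tail_bounds[OF ps sets atomless eps c(1) pos, of "real (\<Delta> N)" "\<pi> j N" "w N"]
          elim range[OF j] d w_pos[OF N(3)] B
        unfolding mnN U_def L_def B_def by auto
      have max: "Q \<le> real (\<Delta> N) * U" "L \<le> Q"
        using max_stat_tail_bounds[OF ps sets, of "\<Delta> N" "m N" "n N" "w N * sqrt (real (m N + n N))" "\<lambda>j. \<pi> j N" U L] tail d
        unfolding mnN Q_def by auto
      have L: "0 < L" by (simp add: L_def)
      hence Q: "0 < Q" using max by linarith
      \<comment> \<open>The factors \<open>\<Delta> N * (N + 1)\<close> and \<open>(N + 1)\<^sup>2\<close> change the exponent by at most \<open>\<epsilon> * B\<close>.\<close>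
      have "ln (real N + 1) \<le> ln ((real N)\<^sup>2)"
      proof -
        have "3 * real N \<le> real N * real N" using N by (intro mult_right_mono) auto
        moreover have "1 \<le> real N" using N by simp
        ultimately have "real N + 1 \<le> (real N)\<^sup>2" unfolding power2_eq_square by linarith
        thus ?thesis using N by (subst ln_le_cancel_iff) auto
      qed
      also have "\<dots> = 2 * ln (real N)" using N by (simp add: ln_realpow)
      finally have "2 * ln (real N + 1) \<le> 4 * ln (real N)" by simp
      also have "\<dots> \<le> \<epsilon> * B" using elim(7) eps by (simp add: B_def field_simps)
      finally have log: "2 * ln (real N + 1) \<le> \<epsilon> * B" .
      have "real (\<Delta> N) * U \<le> (real N + 1)\<^sup>2 * exp (- ((1 - \<epsilon>) / (1 + \<epsilon>) * B / 2))"
        unfolding U_def power2_eq_square mult.assoc using d by (intro mult_right_mono) auto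
      hence "ln Q \<le> ln ((real N + 1)\<^sup>2 * exp (- ((1 - \<epsilon>) / (1 + \<epsilon>) * B / 2)))"
        using max Q by (subst ln_le_cancel_iff) auto
      also have "\<dots> = 2 * ln (real N + 1) - (1 - \<epsilon>) / (1 + \<epsilon>) * B / 2"
        by (simp add: ln_mult ln_realpow)
      finally have upper: "f \<epsilon> * B \<le> - ln Q" using log by (simp add: f_def algebra_simps)
      have "ln L \<le> ln Q" using max L Q by (subst ln_le_cancel_iff) auto
      moreover have "ln L = - ((1 + \<epsilon>) ^ 3 / (1 - \<epsilon>) * B / 2) - 2 * ln (real N + 1)"
        by (simp add: L_def ln_div ln_realpow)
      ultimately have lower: "- ln Q \<le> g \<epsilon> * B" using log by (simp add: g_def algebra_simps)
      have B0: "0 < B" using B by simp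
      have "f \<epsilon> \<le> - ln Q / B \<and> - ln Q / B \<le> g \<epsilon>"
        unfolding pos_le_divide_eq[OF B0] pos_divide_le_eq[OF B0] using upper lower by simp
      thus ?case unfolding Q_def B_def by simp
    qed
  qed
qed

end
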